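(* Let $R$ be a Koszul standard graded $K$-algebra with homogeneous maximal ideal $\mathfrak m$, let $c\ge1$ and $t\ge1$ be integers with $\operatorname{char}K=0$ or $\operatorname{char}K>t$, and set $Z_i=Z_i(\mathfrak m^c,R)$. Then the graded module $Z_t/Z_1^t$ vanishes in all degrees $\ge t(c+1)$, and $Z_1^t$ has a linear resolution over $R$.
   Context: $K$ is a field. For the ideal $\mathfrak m^c$ with minimal homogeneous generators $u_1,\dots,u_n$ (all of degree $c$), let $F$ be the graded free $R$-module with basis $e_1,\dots,e_n$ of degree $c$; the Koszul complex $\bigwedge^\bullet F$ has differential $e_{i_1}\wedge\cdots\wedge e_{i_s}\mapsto\sum_j(-1)^{j+1}u_{i_j}e_{i_1}\wedge\cdots\widehat{e_{i_j}}\cdots\wedge e_{i_s}$, and $Z_i$ is its graded module of $i$-cycles. $Z_1^t$ denotes the image of the multiplication map $\bigwedge^tZ_1\to Z_t$ (wedge product). $R$ is Koszul if $\operatorname{reg}_R(K)=0$, where $\operatorname{reg}_R(N)=\sup_i\{t_i^R(N)-i\}$ and $t_i^R(N)=\max\{j:\operatorname{Tor}_i^R(N,K)_j\ne0\}$. A graded module has a linear resolution over $R$ if it is generated in a single degree $a$ and $\operatorname{Tor}_i^R(N,K)$ is concentrated in degree $a+i$ for all $i$. *)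

theory Defs
  imports Main
begin

definition standard_graded :: "(nat \<Rightarrow> 'a::comm_ring_1 set) \<Rightarrow> bool" where
  "standard_graded G \<longleftrightarrow>
     (\<forall>i. 0 \<in> G i \<and> (\<forall>x\<in>G i. \<forall>y\<in>G i. x + y \<in> G i) \<and> (\<forall>x\<in>G i. - x \<in> G i)) \<and>
     (\<forall>i j. \<forall>x\<in>G i. \<forall>y\<in>G j. x * y \<in> G (i + j)) \<and>
     (\<forall>x. \<exists>!h. (\<forall>i. h i \<in> G i) \<and> finite {i. h i \<noteq> 0} \<and> x = (\<Sum>i\<in>{i. h i \<noteq> 0}. h i)) \<and>
     \<comment> \<open>R_0 = K is a field\<close>
     1 \<in> G 0 \<and> (\<forall>x\<in>G 0. x \<noteq> 0 \<longrightarrow> (\<exists>y\<in>G 0. x * y = 1)) \<and>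
     \<comment> \<open>R_1 is finite dimensional over K\<close>
     (\<exists>B. finite B \<and> B \<subseteq> G 1 \<and> (\<forall>x\<in>G 1. \<exists>f. (\<forall>b\<in>B. f b \<in> G 0) \<and> x = (\<Sum>b\<in>B. f b * b))) \<and>
     \<comment> \<open>R is generated by R_1: R_{i+1} = R_1 R_i\<close>
     (\<forall>i. \<forall>x\<in>G (Suc i). \<exists>l. set l \<subseteq> G 1 \<times> G i \<and> x = sum_list (map (\<lambda>(a, b). a * b) l))"

definition ideal_span :: "'a::comm_ring_1 set \<Rightarrow> 'a set" where
  "ideal_span S = {x. \<exists>l. set (map snd l) \<subseteq> S \<and> x = sum_list (map (\<lambda>(r, s). r * s) l)}"

definition max_ideal :: "(nat \<Rightarrow> 'a::comm_ring_1 set) \<Rightarrow> 'a set" where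
  "max_ideal G = ideal_span (\<Union>i\<in>{1..}. G i)"

definition max_ideal_pow :: "(nat \<Rightarrow> 'a::comm_ring_1 set) \<Rightarrow> nat \<Rightarrow> 'a set" where
  "max_ideal_pow G c = ideal_span {prod_list xs | xs. length xs = c \<and> set xs \<subseteq> max_ideal G}"

definition min_hom_gens :: "(nat \<Rightarrow> 'a::comm_ring_1 set) \<Rightarrow> nat \<Rightarrow> nat \<Rightarrow> (nat \<Rightarrow> 'a) \<Rightarrow> bool" where
  "min_hom_gens G c n u \<longleftrightarrow> (\<forall>i<n. u i \<in> G c) \<and>
     ideal_span (u ` {..<n}) = max_ideal_pow G c \<and>
     (\<forall>k<n. ideal_span (u ` ({..<n} - {k})) \<noteq> max_ideal_pow G c)"

(* Elements of the exterior algebra of F = R^n: coefficient functions on subsets of {0..<n};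
   the coefficient at S is the coefficient of e_S = e_{i_1} /\ ... /\ e_{i_s}, i_1 < ... < i_s. *)
definition wedge_pow :: "nat \<Rightarrow> nat \<Rightarrow> (nat set \<Rightarrow> 'a::comm_ring_1) set" where
  "wedge_pow n s = {x. \<forall>S. x S \<noteq> 0 \<longrightarrow> S \<subseteq> {..<n} \<and> card S = s}"

definition kdiff :: "nat \<Rightarrow> (nat \<Rightarrow> 'a::comm_ring_1) \<Rightarrow> (nat set \<Rightarrow> 'a) \<Rightarrow> (nat set \<Rightarrow> 'a)" where
  "kdiff n u x = (\<lambda>T. if T \<subseteq> {..<n} then
      (\<Sum>i\<in>{..<n} - T. (-1) ^ card {k\<in>T. k < i} * u i * x (insert i T)) else 0)"

definition cycles :: "nat \<Rightarrow> (nat \<Rightarrow> 'a::comm_ring_1) \<Rightarrow> nat \<Rightarrow> (nat set \<Rightarrow> 'a) set" where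
  "cycles n u s = {x \<in> wedge_pow n s. kdiff n u x = (\<lambda>T. 0)}"

definition wedge :: "(nat set \<Rightarrow> 'a::comm_ring_1) \<Rightarrow> (nat set \<Rightarrow> 'a) \<Rightarrow> (nat set \<Rightarrow> 'a)" where
  "wedge x y = (\<lambda>S. if finite S then
      (\<Sum>A\<in>Pow S. (-1) ^ card {(a, b). a \<in> A \<and> b \<in> S - A \<and> b < a} * x A * y (S - A)) else 0)"

definition ext_one :: "nat set \<Rightarrow> 'a::comm_ring_1" where
  "ext_one = (\<lambda>S. if S = {} then 1 else 0)"

definition rspan :: "(nat set \<Rightarrow> 'a::comm_ring_1) set \<Rightarrow> (nat set \<Rightarrow> 'a) set" where
  "rspan V = {x. \<exists>l. set (map snd l) \<subseteq> V \<and> x = (\<lambda>S. sum_list (map (\<lambda>(r, v). r * v S) l))}"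

definition cycles1_pow :: "nat \<Rightarrow> (nat \<Rightarrow> 'a::comm_ring_1) \<Rightarrow> nat \<Rightarrow> (nat set \<Rightarrow> 'a) set" where
  "cycles1_pow n u t = rspan {foldr wedge zs ext_one | zs. length zs = t \<and> set zs \<subseteq> cycles n u 1}"

(* homogeneous of degree d in /\^s F, where e_S has degree s*c *)
definition ext_homog :: "(nat \<Rightarrow> 'a::comm_ring_1 set) \<Rightarrow> nat \<Rightarrow> nat \<Rightarrow> nat \<Rightarrow> (nat set \<Rightarrow> 'a) \<Rightarrow> bool" where
  "ext_homog G c s d x \<longleftrightarrow> s * c \<le> d \<and> (\<forall>S. x S \<in> G (d - s * c))"

definition vecs :: "nat \<Rightarrow> (nat \<Rightarrow> 'a::comm_ring_1) set" where
  "vecs m = {x. \<forall>j\<ge>m. x j = 0}"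

definition mat_app :: "(nat \<Rightarrow> nat \<Rightarrow> 'a::comm_ring_1) \<Rightarrow> nat \<Rightarrow> nat \<Rightarrow> (nat \<Rightarrow> 'a) \<Rightarrow> (nat \<Rightarrow> 'a)" where
  "mat_app A m n x = (\<lambda>r. if r < m then (\<Sum>j<n. A r j * x j) else 0)"

definition mat_ker :: "(nat \<Rightarrow> nat \<Rightarrow> 'a::comm_ring_1) \<Rightarrow> nat \<Rightarrow> nat \<Rightarrow> (nat \<Rightarrow> 'a) set" where
  "mat_ker A m n = {x \<in> vecs n. mat_app A m n x = (\<lambda>r. 0)}"

definition mat_im :: "(nat \<Rightarrow> nat \<Rightarrow> 'a::comm_ring_1) \<Rightarrow> nat \<Rightarrow> nat \<Rightarrow> (nat \<Rightarrow> 'a) set" where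
  "mat_im A m n = mat_app A m n ` vecs n"

(* exact complex  ... -> R(-(a+i+1))^{b(i+1)} --phi i--> R(-(a+i))^{b i} -> ...  with linear maps *)
definition linear_tail :: "(nat \<Rightarrow> 'a::comm_ring_1 set) \<Rightarrow> (nat \<Rightarrow> nat) \<Rightarrow> (nat \<Rightarrow> nat \<Rightarrow> nat \<Rightarrow> 'a) \<Rightarrow> bool" where
  "linear_tail G b \<phi> \<longleftrightarrow> (\<forall>i. (\<forall>r<b i. \<forall>j<b (Suc i). \<phi> i r j \<in> G 1) \<and>
      mat_ker (\<phi> i) (b i) (b (Suc i)) = mat_im (\<phi> (Suc i)) (b (Suc i)) (b (Suc (Suc i))))"

(* Koszul: the residue field K = R/m has a linear (graded free) resolution over R:
   F_0 = R, F_0 -> K the canonical surjection (kernel m), all further maps linear. *)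
definition koszul :: "(nat \<Rightarrow> 'a::comm_ring_1 set) \<Rightarrow> bool" where
  "koszul G \<longleftrightarrow> (\<exists>b \<phi>. b 0 = 1 \<and>
      mat_im (\<phi> 0) 1 (b 1) = {x \<in> vecs 1. x 0 \<in> max_ideal G} \<and> linear_tail G b \<phi>)"

(* A graded submodule M of /\^s F (basis elements of degree s*c) has a linear resolution:
   generated in a single degree a by psi_0,...,psi_{b0-1}, with the syzygy chain linear. *)
definition ext_linear_resolution ::
  "(nat \<Rightarrow> 'a::comm_ring_1 set) \<Rightarrow> nat \<Rightarrow> nat \<Rightarrow> (nat set \<Rightarrow> 'a) set \<Rightarrow> bool" where
  "ext_linear_resolution G c s M \<longleftrightarrow> (\<exists>a b \<psi> \<phi>.
      (\<forall>j<b 0. ext_homog G c s a (\<psi> j)) \<and>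
      (\<lambda>x. (\<lambda>S. \<Sum>j<b 0. x j * \<psi> j S)) ` vecs (b 0) = M \<and>
      {x \<in> vecs (b 0). (\<lambda>S. \<Sum>j<b 0. x j * \<psi> j S) = (\<lambda>S. 0)} = mat_im (\<phi> 0) (b 0) (b 1) \<and>
      linear_tail G b \<phi>)"

end

theory Submission
  imports Defs
begin

text \<open>
  Let \<open>P\<close> be the linear resolution of \<open>K\<close>. Vanishing of \<open>Tor\<^sub>i(M, K)\<close> in degrees above \<open>a + i\<close> is
  exactness of \<open>M \<otimes> P\<close> at the \<open>i\<close>-th term in these degrees, so that all arguments with long exact
  sequences become chases with tuples of elements of \<open>M\<close> and the matrices of \<open>P\<close>. In degrees
  normalised by \<open>deg e\<^sub>j = 0\<close>, the claim is that \<open>Z\<^sub>t\<close> is linear from degree \<open>t\<close> on and that its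
  components of degree \<open>\<ge> t\<close> lie in \<open>Z\<^sub>1\<^sup>t\<close>. Both follow by induction on \<open>t\<close>, starting from \<open>Z\<^sub>0 = R\<close>:
  contraction with the dual basis embeds \<open>Z\<^sub>t\<^sub>+\<^sub>1\<close> into the kernel of \<open>F \<otimes> Z\<^sub>t \<rightarrow> \<mm>\<^sup>c Z\<^sub>t\<close>, and it is split
  by the wedge product because \<open>t + 1\<close> is invertible. As \<open>Z\<^sub>t\<close> is generated in degree \<open>t\<close> with
  linear syzygies, high degree elements of that kernel come from \<open>Z\<^sub>1 \<otimes> Z\<^sub>t\<close>. Finally, choosing bases
  of successive syzygy modules turns linearity into an explicit linear resolution.
\<close>

section \<open>Ideals and graded rings\<close>

lemma ideal_span_zero: "0 \<in> ideal_span S"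
  unfolding ideal_span_def by (auto intro!: exI[of _ "[]"])

lemma ideal_span_add_base: "s \<in> S \<Longrightarrow> y \<in> ideal_span S \<Longrightarrow> r * s + y \<in> ideal_span S"
  unfolding ideal_span_def by clarify (rule_tac x = "(r, s) # l" in exI, auto)

lemma ideal_span_induct [consumes 1, case_names zero add]:
  assumes "x \<in> ideal_span S" "P 0" "\<And>r s y. s \<in> S \<Longrightarrow> y \<in> ideal_span S \<Longrightarrow> P y \<Longrightarrow> P (r * s + y)"
  shows "P x"
proof -
  obtain l where l: "set (map snd l) \<subseteq> S" "x = sum_list (map (\<lambda>(r, s). r * s) l)"
    using assms(1) unfolding ideal_span_def by blast
  have "sum_list (map (\<lambda>(r, s). r * s) l) \<in> ideal_span S \<and> P (sum_list (map (\<lambda>(r, s). r * s) l))"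
    using l(1)
    by (induction l) (auto simp: assms(2) ideal_span_zero intro: assms(3) ideal_span_add_base)
  then show ?thesis using l(2) by simp
qed

lemma ideal_span_base: "s \<in> S \<Longrightarrow> s \<in> ideal_span S"
  using ideal_span_add_base[OF _ ideal_span_zero, of s S 1] by simp

lemma ideal_span_add:
  assumes "x \<in> ideal_span S" "y \<in> ideal_span S"
  shows "x + y \<in> ideal_span S"
  using assms by (induction x rule: ideal_span_induct) (auto simp: add.assoc intro: ideal_span_add_base)

lemma ideal_span_mult:
  assumes "x \<in> ideal_span S"
  shows "a * x \<in> ideal_span S"
  using assms
  by (induction x rule: ideal_span_induct)
    (auto simp: ideal_span_zero distrib_left mult.assoc[symmetric] intro: ideal_span_add_base)

lemma ideal_span_sum:
  assumes "\<And>j. j \<in> J \<Longrightarrow> f j \<in> ideal_span S"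
  shows "sum f J \<in> ideal_span S"
  using assms by (induction J rule: infinite_finite_induct) (auto intro: ideal_span_zero ideal_span_add)

lemma ideal_span_subset: "S \<subseteq> ideal_span T \<Longrightarrow> ideal_span S \<subseteq> ideal_span T"
proof
  fix x assume ST: "S \<subseteq> ideal_span T" and "x \<in> ideal_span S"
  from this(2) show "x \<in> ideal_span T"
    by (induction x rule: ideal_span_induct) (use ST in \<open>auto intro: ideal_span_zero ideal_span_add ideal_span_mult\<close>)
qed

lemma ideal_span_image:
  assumes "x \<in> ideal_span (u ` {..<n::nat})"
  shows "\<exists>r. x = (\<Sum>j<n. r j * u j)"
  using assms
proof (induction x rule: ideal_span_induct)
  case zero
  show ?case by (rule exI[of _ "\<lambda>_. 0"]) simp
next
  case (add a s y)
  then obtain r j where r: "y = (\<Sum>j<n. r j * u j)" and j: "j < n" "s = u j" by auto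
  have "(\<Sum>i<n. (r i + (if i = j then a else 0)) * u i)
      = (\<Sum>i<n. r i * u i) + (\<Sum>i<n. if i = j then a * u i else 0)"
    unfolding sum.distrib[symmetric] by (rule sum.cong) (auto simp: algebra_simps)
  also have "\<dots> = a * s + y"
    using r j by (simp add: add.commute)
  finally show ?case by metis
qed

locale graded_ring =
  fixes G :: "nat \<Rightarrow> 'a::comm_ring_1 set"
  assumes std: "standard_graded G"
begin

lemma std_unfolded:
  "\<forall>i. 0 \<in> G i \<and> (\<forall>x\<in>G i. \<forall>y\<in>G i. x + y \<in> G i) \<and> (\<forall>x\<in>G i. - x \<in> G i)"
  "\<forall>i j. \<forall>x\<in>G i. \<forall>y\<in>G j. x * y \<in> G (i + j)"
  "\<forall>x. \<exists>!h. (\<forall>i. h i \<in> G i) \<and> finite {i. h i \<noteq> 0} \<and> x = (\<Sum>i\<in>{i. h i \<noteq> 0}. h i)"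
  "1 \<in> G 0" "\<forall>x\<in>G 0. x \<noteq> 0 \<longrightarrow> (\<exists>y\<in>G 0. x * y = 1)"
  "\<forall>i. \<forall>x\<in>G (Suc i). \<exists>l. set l \<subseteq> G 1 \<times> G i \<and> x = sum_list (map (\<lambda>(a, b). a * b) l)"
  using std[unfolded standard_graded_def] by simp_all

lemma G_zero [simp, intro]: "0 \<in> G i"
  and G_add [intro]: "x \<in> G i \<Longrightarrow> y \<in> G i \<Longrightarrow> x + y \<in> G i"
  and G_minus [intro]: "x \<in> G i \<Longrightarrow> - x \<in> G i"
  using std_unfolded(1) by blast+

lemma G_mult [intro]: "x \<in> G i \<Longrightarrow> y \<in> G j \<Longrightarrow> x * y \<in> G (i + j)"
  using std_unfolded(2) by blast

lemma G_one [simp, intro]: "1 \<in> G 0"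
  by (rule std_unfolded(4))

lemma G_inv: "x \<in> G 0 \<Longrightarrow> x \<noteq> 0 \<Longrightarrow> \<exists>y\<in>G 0. x * y = 1"
  using std_unfolded(5) by blast

lemma G_decomp: "\<exists>!h. (\<forall>i. h i \<in> G i) \<and> finite {i. h i \<noteq> 0} \<and> x = (\<Sum>i\<in>{i. h i \<noteq> 0}. h i)"
  by (rule spec[OF std_unfolded(3)])

lemma G_gen: "x \<in> G (Suc i) \<Longrightarrow> \<exists>l. set l \<subseteq> G 1 \<times> G i \<and> x = sum_list (map (\<lambda>(a, b). a * b) l)"
  by (rule bspec[OF spec[OF std_unfolded(6)]])

lemma G_diff [intro]: "x \<in> G i \<Longrightarrow> y \<in> G i \<Longrightarrow> x - y \<in> G i"
  using G_add[OF _ G_minus, of x i y] by simp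

lemma G_sum [intro]: "(\<And>j. j \<in> J \<Longrightarrow> f j \<in> G i) \<Longrightarrow> sum f J \<in> G i"
  by (induction J rule: infinite_finite_induct) auto

lemma G_mult0 [intro]: "x \<in> G 0 \<Longrightarrow> y \<in> G j \<Longrightarrow> x * y \<in> G j"
  using G_mult[of x 0 y j] by simp

lemma G_mult1: "x \<in> G 1 \<Longrightarrow> y \<in> G j \<Longrightarrow> x * y \<in> G (Suc j)"
  using G_mult[of x 1 y j] by simp

lemma G_sign [simp, intro]: "(-1) ^ k \<in> G 0"
  by (induction k) auto

lemma G_of_nat [simp, intro]: "of_nat k \<in> G 0"
  by (induction k) auto

section \<open>Homogeneous components and orders of elements\<close>

definition hcomp :: "nat \<Rightarrow> 'a \<Rightarrow> 'a" where
  "hcomp i x = (THE h. (\<forall>i. h i \<in> G i) \<and> finite {i. h i \<noteq> 0} \<and> x = (\<Sum>i\<in>{i. h i \<noteq> 0}. h i)) i"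

lemma hcomp_props:
  "(\<forall>i. hcomp i x \<in> G i) \<and> finite {i. hcomp i x \<noteq> 0} \<and> x = (\<Sum>i\<in>{i. hcomp i x \<noteq> 0}. hcomp i x)"
  unfolding hcomp_def by (rule theI'[OF G_decomp])

lemma hcomp_mem [simp, intro]: "hcomp i x \<in> G i"
  and hcomp_finite: "finite {i. hcomp i x \<noteq> 0}"
  using hcomp_props by blast+

lemma hcomp_decomp:
  assumes "finite I" "{i. hcomp i x \<noteq> 0} \<subseteq> I"
  shows "x = (\<Sum>i\<in>I. hcomp i x)"
proof -
  have "x = (\<Sum>i\<in>{i. hcomp i x \<noteq> 0}. hcomp i x)" using hcomp_props by blast
  also have "\<dots> = (\<Sum>i\<in>I. hcomp i x)" by (rule sum.mono_neutral_left) (use assms in auto)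
  finally show ?thesis .
qed

lemma hcomp_unique:
  assumes "\<And>i. h i \<in> G i" "finite I" "\<And>i. i \<notin> I \<Longrightarrow> h i = 0" "x = (\<Sum>i\<in>I. h i)"
  shows "hcomp i x = h i"
proof -
  have fin: "finite {i. h i \<noteq> 0}" by (rule finite_subset[OF _ assms(2)]) (use assms(3) in auto)
  have "x = (\<Sum>i\<in>{i. h i \<noteq> 0}. h i)"
    unfolding assms(4) by (rule sum.mono_neutral_right) (use assms in auto)
  with fin assms(1) have "(\<forall>i. h i \<in> G i) \<and> finite {i. h i \<noteq> 0} \<and> x = (\<Sum>i\<in>{i. h i \<noteq> 0}. h i)"
    by blast
  then show ?thesis unfolding hcomp_def by (subst the1_equality[OF G_decomp]) simp_all
qed

lemma hcomp_homog: "x \<in> G i \<Longrightarrow> hcomp j x = (if j = i then x else 0)"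
  by (rule hcomp_unique[where I = "{i}"]) auto

lemma hcomp_zero [simp]: "hcomp i 0 = 0"
  by (rule hcomp_unique[where I = "{}"]) auto

lemma hcomp_add: "hcomp i (x + y) = hcomp i x + hcomp i y"
proof (rule hcomp_unique[where I = "{i. hcomp i x \<noteq> 0} \<union> {i. hcomp i y \<noteq> 0}"])
  let ?I = "{i. hcomp i x \<noteq> 0} \<union> {i. hcomp i y \<noteq> 0}"
  have fin: "finite ?I" using hcomp_finite by auto
  have "x = sum (\<lambda>i. hcomp i x) ?I" "y = sum (\<lambda>i. hcomp i y) ?I"
    by (rule hcomp_decomp[OF fin], auto)+
  then show "x + y = (\<Sum>i\<in>?I. hcomp i x + hcomp i y)" by (simp add: sum.distrib)
  show "finite ?I" by (rule fin)
qed auto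

lemma hcomp_sum: "hcomp i (sum f J) = (\<Sum>j\<in>J. hcomp i (f j))"
  by (induction J rule: infinite_finite_induct) (auto simp: hcomp_add)

lemma hcomp_mult_homog:
  assumes "r \<in> G i"
  shows "hcomp j (r * x) = (if j < i then 0 else r * hcomp (j - i) x)"
proof (rule hcomp_unique[where I = "(+) i ` {k. hcomp k x \<noteq> 0}"])
  fix j
  show "(if j < i then 0 else r * hcomp (j - i) x) \<in> G j"
    using G_mult[OF assms, of "hcomp (j - i) x" "j - i"] by auto
  show "finite ((+) i ` {k. hcomp k x \<noteq> 0})" using hcomp_finite by auto
  show "(if j < i then 0 else r * hcomp (j - i) x) = 0" if "j \<notin> (+) i ` {k. hcomp k x \<noteq> 0}"
  proof (cases "j < i")
    case False
    have "hcomp (j - i) x = 0"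
    proof (rule ccontr)
      assume "hcomp (j - i) x \<noteq> 0"
      then have "i + (j - i) \<in> (+) i ` {k. hcomp k x \<noteq> 0}" by blast
      then show False using that False by simp
    qed
    then show ?thesis by simp
  qed simp
  have "r * x = (\<Sum>k\<in>{k. hcomp k x \<noteq> 0}. r * hcomp k x)"
    by (subst hcomp_decomp[OF hcomp_finite order_refl, of x]) (simp add: sum_distrib_left)
  then show "r * x = (\<Sum>j\<in>(+) i ` {k. hcomp k x \<noteq> 0}. if j < i then 0 else r * hcomp (j - i) x)"
    by (simp add: sum.reindex)
qed

lemma hcomp_mult_homog_shift: "r \<in> G i \<Longrightarrow> hcomp (i + j) (r * x) = r * hcomp j x"
  by (simp add: hcomp_mult_homog)

lemma hcomp_mult_homog_shift': "r \<in> G i \<Longrightarrow> hcomp (i + j) (x * r) = hcomp j x * r"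
  using hcomp_mult_homog_shift[of r i j x] by (simp add: mult.commute)

text \<open>One bound \<open>N\<close> serves all coordinates in \<open>X\<close>, so that a tuple
  splits into homogeneous tuples by a single finite sum.\<close>

lemma hcomp_common_decomp:
  assumes "finite X"
  shows "\<exists>N. \<forall>s\<in>X. \<forall>M\<ge>N. f s = (\<Sum>e<M. hcomp e (f s))"
proof -
  have "finite (\<Union>s\<in>X. {i. hcomp i (f s) \<noteq> 0})" using assms hcomp_finite by auto
  then obtain N where N: "(\<Union>s\<in>X. {i. hcomp i (f s) \<noteq> 0}) \<subseteq> {..<N}"
    unfolding finite_nat_set_iff_bounded by blast
  have "f s = (\<Sum>e<M. hcomp e (f s))" if "s \<in> X" "M \<ge> N" for s M
    by (rule hcomp_decomp) (use N that in fastforce)+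
  then show ?thesis by blast
qed

text \<open>This is the \<open>p\<close>-th power of the homogeneous maximal ideal, described by
  components so that membership is checked degree by degree.\<close>

definition low :: "nat \<Rightarrow> 'a set" where
  "low p = {x. \<forall>i<p. hcomp i x = 0}"

lemma low_sum: "(\<And>j. j \<in> J \<Longrightarrow> f j \<in> low p) \<Longrightarrow> sum f J \<in> low p"
  by (auto simp: low_def hcomp_sum)

lemma low_mult:
  assumes "x \<in> low p" "y \<in> low q"
  shows "x * y \<in> low (p + q)"
proof -
  have "hcomp i (x * y) = 0" if i: "i < p + q" for i
  proof -
    have "hcomp i (hcomp k x * y) = 0" for k
    proof (cases "k < p")
      case True
      then show ?thesis using assms(1) by (simp add: low_def)
    next
      case False
      then have "i < k \<or> i - k < q" using i by auto
      then show ?thesis using assms(2) by (auto simp: hcomp_mult_homog[OF hcomp_mem] low_def)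
    qed
    moreover have "x * y = (\<Sum>k\<in>{k. hcomp k x \<noteq> 0}. hcomp k x * y)"
      by (subst hcomp_decomp[OF hcomp_finite order_refl, of x]) (simp add: sum_distrib_right)
    ultimately show ?thesis by (simp add: hcomp_sum)
  qed
  then show ?thesis by (simp add: low_def)
qed

section \<open>Powers of the maximal ideal and their minimal generators\<close>

lemma G_subset_max_ideal: "G (Suc d) \<subseteq> max_ideal G"
  unfolding max_ideal_def by (auto intro!: ideal_span_base)

lemma G_subset_max_ideal_pow: "G c \<subseteq> max_ideal_pow G c"
proof (induction c)
  case 0
  have "(1::'a) \<in> ideal_span {prod_list xs |xs. length xs = 0 \<and> set xs \<subseteq> max_ideal G}"
    by (rule ideal_span_base) auto
  then show ?case
    using ideal_span_mult[of 1 _] unfolding max_ideal_pow_def by fastforce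
next
  case (Suc c)
  \<comment> \<open>A linear form lengthens each generating product by one factor, just as
    \<open>G (Suc c)\<close> consists of sums of products from \<open>G 1\<close> and
    \<open>G c\<close>.\<close>
  have mult: "a * y \<in> max_ideal_pow G (Suc c)" if "a \<in> G 1" "y \<in> max_ideal_pow G c" for a y
    using that(2) unfolding max_ideal_pow_def
  proof (induction y rule: ideal_span_induct)
    case zero
    show ?case by (simp add: ideal_span_zero)
  next
    case (add r s y)
    then obtain xs where xs: "s = prod_list xs" "length xs = c" "set xs \<subseteq> max_ideal G" by auto
    have "a * s \<in> {prod_list xs |xs. length xs = Suc c \<and> set xs \<subseteq> max_ideal G}"
      using xs that(1) G_subset_max_ideal[of 0] by (auto intro!: exI[of _ "a # xs"])
    from ideal_span_add_base[OF this add.IH, of r] show ?case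
      by (simp add: algebra_simps)
  qed
  show ?case
  proof
    fix x assume "x \<in> G (Suc c)"
    from G_gen[OF this] obtain l where l: "set l \<subseteq> G 1 \<times> G c" "x = sum_list (map (\<lambda>(a, b). a * b) l)"
      by blast
    have "sum_list (map (\<lambda>(a, b). a * b) l) \<in> max_ideal_pow G (Suc c)"
      using l(1)
    proof (induction l)
      case Nil
      then show ?case by (simp add: max_ideal_pow_def ideal_span_zero)
    next
      case (Cons p l)
      then show ?case
        using mult Suc.IH by (auto simp: max_ideal_pow_def intro!: ideal_span_add)
    qed
    then show "x \<in> max_ideal_pow G (Suc c)" using l(2) by simp
  qed
qed

text \<open>Compare components of degree \<open>c\<close> on both sides: since every
  \<open>u j\<close> has degree \<open>c\<close>, only the degree 0 parts of the coefficients
  survive.\<close>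

lemma min_hom_gens_span:
  assumes "min_hom_gens G c n u" "x \<in> G c"
  shows "\<exists>k. (\<forall>j. k j \<in> G 0) \<and> x = (\<Sum>j<n. k j * u j)"
proof -
  have u: "u j \<in> G c" if "j < n" for j using assms(1) that by (simp add: min_hom_gens_def)
  have "x \<in> ideal_span (u ` {..<n})"
    using assms G_subset_max_ideal_pow by (auto simp: min_hom_gens_def)
  from ideal_span_image[OF this] obtain r where r: "x = (\<Sum>j<n. r j * u j)" by blast
  have "x = hcomp c x" using assms(2) by (simp add: hcomp_homog)
  also have "\<dots> = (\<Sum>j<n. hcomp c (u j * r j))" by (simp add: r hcomp_sum mult.commute)
  also have "\<dots> = (\<Sum>j<n. hcomp 0 (r j) * u j)"
    by (intro sum.cong refl, subst hcomp_mult_homog[OF u]) (simp_all add: mult.commute)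
  finally show ?thesis by (intro exI[of _ "\<lambda>j. hcomp 0 (r j)"]) auto
qed

text \<open>A nonzero scalar is invertible, so a nontrivial relation over the ground field would
  express one generator through the others, against minimality.\<close>

lemma min_hom_gens_indep:
  assumes "min_hom_gens G c n u" "\<And>j. k j \<in> G 0" "(\<Sum>j<n. k j * u j) = 0" "i < n"
  shows "k i = 0"
proof (rule ccontr)
  let ?J = "{..<n} - {i}"
  assume "k i \<noteq> 0"
  then obtain d where d: "k i * d = 1" using G_inv assms(2) by blast
  have "(\<Sum>j<n. k j * u j) = k i * u i + (\<Sum>j\<in>?J. k j * u j)"
    by (rule sum.remove) (use assms(4) in auto)
  then have "k i * u i = - (\<Sum>j\<in>?J. k j * u j)"
    using assms(3) by (simp add: eq_neg_iff_add_eq_0)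
  then have "d * (k i * u i) = (- d) * (\<Sum>j\<in>?J. k j * u j)" by simp
  moreover have "d * (k i * u i) = u i"
    using d by (metis mult.assoc mult.commute mult_1)
  moreover have "(\<Sum>j\<in>?J. k j * u j) \<in> ideal_span (u ` ?J)"
    by (intro ideal_span_sum ideal_span_mult ideal_span_base) auto
  ultimately have ui: "u i \<in> ideal_span (u ` ?J)" using ideal_span_mult by metis
  have "u ` {..<n} \<subseteq> ideal_span (u ` ?J)"
  proof clarify
    fix j assume "j < n"
    then show "u j \<in> ideal_span (u ` ?J)" using ui by (cases "j = i") (auto intro: ideal_span_base)
  qed
  then have "ideal_span (u ` {..<n}) \<subseteq> ideal_span (u ` ?J)" by (rule ideal_span_subset)
  moreover have "ideal_span (u ` ?J) \<subseteq> ideal_span (u ` {..<n})"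
    by (rule ideal_span_subset) (auto intro: ideal_span_base)
  ultimately show False using assms(1,4) by (auto simp: min_hom_gens_def)
qed

end

section \<open>Graded modules and bases over the ground field\<close>

context graded_ring
begin

text \<open>A family of graded pieces inside a module of coordinate functions. The index type is
  arbitrary because syzygies are indexed by numbers and exterior elements by sets; negatives come
  from the scalar -1 in \<open>G 0\<close>.\<close>

definition graded_module :: "(nat \<Rightarrow> ('x \<Rightarrow> 'a) set) \<Rightarrow> bool" where
  "graded_module M \<longleftrightarrow> (\<forall>d. (\<lambda>s. 0) \<in> M d) \<and>
     (\<forall>d. \<forall>x\<in>M d. \<forall>y\<in>M d. (\<lambda>s. x s + y s) \<in> M d) \<and>
     (\<forall>i d. \<forall>r\<in>G i. \<forall>x\<in>M d. (\<lambda>s. r * x s) \<in> M (i + d))"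

lemma graded_module_zero: "graded_module M \<Longrightarrow> (\<lambda>s. 0) \<in> M d"
  and graded_module_add: "graded_module M \<Longrightarrow> x \<in> M d \<Longrightarrow> y \<in> M d \<Longrightarrow> (\<lambda>s. x s + y s) \<in> M d"
  and graded_module_mult: "graded_module M \<Longrightarrow> r \<in> G i \<Longrightarrow> x \<in> M d \<Longrightarrow> (\<lambda>s. r * x s) \<in> M (i + d)"
  by (auto simp: graded_module_def)

lemma graded_module_mult0: "graded_module M \<Longrightarrow> r \<in> G 0 \<Longrightarrow> x \<in> M d \<Longrightarrow> (\<lambda>s. r * x s) \<in> M d"
  using graded_module_mult[of M r 0 x d] by simp

lemma graded_module_diff:
  assumes "graded_module M" "x \<in> M d" "y \<in> M d"
  shows "(\<lambda>s. x s - y s) \<in> M d"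
  using graded_module_add[OF assms(1,2) graded_module_mult0[OF assms(1) G_minus[OF G_one] assms(3)]]
  by simp

lemma graded_module_sum:
  assumes "graded_module M" "\<And>j. j \<in> J \<Longrightarrow> x j \<in> M d"
  shows "(\<lambda>s. \<Sum>j\<in>J. x j s) \<in> M d"
  using assms(2)
  by (induction J rule: infinite_finite_induct)
    (auto intro: graded_module_zero graded_module_add assms(1))

lemma graded_module_lincomb:
  assumes "graded_module M" "\<And>j. j \<in> J \<Longrightarrow> r j \<in> G i" "\<And>j. j \<in> J \<Longrightarrow> x j \<in> M d"
  shows "(\<lambda>s. \<Sum>j\<in>J. r j * x j s) \<in> M (i + d)"
  by (rule graded_module_sum) (auto intro: graded_module_mult assms)

section \<open>Vector spaces over the ground field, whose scalars are the subset \<open>G 0\<close>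
  of the ring\<close>

inductive_set kspan :: "('x \<Rightarrow> 'a) set \<Rightarrow> ('x \<Rightarrow> 'a) set" for S where
  kspan_zero: "(\<lambda>s. 0) \<in> kspan S"
| kspan_add_base: "b \<in> S \<Longrightarrow> k \<in> G 0 \<Longrightarrow> x \<in> kspan S \<Longrightarrow> (\<lambda>s. k * b s + x s) \<in> kspan S"

lemma kspan_base:
  assumes "b \<in> S"
  shows "b \<in> kspan S"
  using kspan_add_base[OF assms G_one kspan_zero] by simp

lemma kspan_add:
  assumes "x \<in> kspan S" "y \<in> kspan S"
  shows "(\<lambda>s. x s + y s) \<in> kspan S"
  using assms
proof (induction rule: kspan.induct)
  case (kspan_add_base b k x)
  then show ?case using kspan.kspan_add_base[of b S k "\<lambda>s. x s + y s"] by (simp add: add.assoc)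
qed simp

lemma kspan_mult:
  assumes "x \<in> kspan S" "k \<in> G 0"
  shows "(\<lambda>s. k * x s) \<in> kspan S"
  using assms
proof (induction rule: kspan.induct)
  case (kspan_add_base b l x)
  then show ?case using kspan.kspan_add_base[of b S "k * l" "\<lambda>s. k * x s"]
    by (simp add: distrib_left mult.assoc G_mult0)
qed (simp add: kspan_zero)

lemma kspan_sum:
  assumes "\<And>j. j \<in> J \<Longrightarrow> x j \<in> kspan S"
  shows "(\<lambda>s. \<Sum>j\<in>J. x j s) \<in> kspan S"
  using assms
  by (induction J rule: infinite_finite_induct) (auto intro: kspan_zero kspan_add)

lemma kspan_insert:
  assumes "x \<in> kspan (insert b S)"
  shows "\<exists>k f. k \<in> G 0 \<and> f \<in> kspan S \<and> x = (\<lambda>s. k * b s + f s)"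
  using assms
proof (induction rule: kspan.induct)
  case kspan_zero
  show ?case by (rule exI[of _ 0], rule exI[of _ "\<lambda>s. 0"]) (simp add: kspan.kspan_zero)
next
  case (kspan_add_base a l x)
  then obtain k f where kf: "k \<in> G 0" "f \<in> kspan S" "x = (\<lambda>s. k * b s + f s)" by blast
  show ?case
  proof (cases "a = b")
    case True
    then show ?thesis
      by (intro exI[of _ "l + k"] exI[of _ f])
        (use kf kspan_add_base in \<open>auto simp: algebra_simps\<close>)
  next
    case False
    then have "(\<lambda>s. l * a s + f s) \<in> kspan S"
      using kspan_add_base(1,2) kf(2) by (auto intro: kspan.kspan_add_base)
    then show ?thesis
      by (intro exI[of _ k] exI[of _ "\<lambda>s. l * a s + f s"]) (use kf in \<open>auto simp: algebra_simps\<close>)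
  qed
qed

text \<open>The entries of \<open>g\<close> from \<open>m\<close> on do not enter the sums; they too
  are kept in \<open>V\<close>, so that \<open>g j \<in> V\<close> can be used without an index
  bound.\<close>

definition is_basis :: "('x \<Rightarrow> 'a) set \<Rightarrow> nat \<Rightarrow> (nat \<Rightarrow> 'x \<Rightarrow> 'a) \<Rightarrow> bool" where
  "is_basis V m g \<longleftrightarrow> (\<forall>j. g j \<in> V) \<and>
     (\<forall>x\<in>V. \<exists>k. (\<forall>j. k j \<in> G 0) \<and> x = (\<lambda>s. \<Sum>j<m. k j * g j s)) \<and>
     (\<forall>k. (\<forall>j. k j \<in> G 0) \<longrightarrow> (\<forall>s. (\<Sum>j<m. k j * g j s) = 0) \<longrightarrow> (\<forall>j<m. k j = 0))"

text \<open>Dropping \<open>b\<close> from the spanning set lowers the dimension of \<open>V\<close>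
  by at most one: an \<open>x0\<close> in \<open>V\<close> outside \<open>kspan F\<close> has an
  invertible coefficient at \<open>b\<close>, and subtracting a multiple of \<open>x0\<close>
  removes \<open>b\<close> from any element of \<open>V\<close>.\<close>

lemma exists_basis:
  assumes "finite S" "(\<lambda>s. 0) \<in> V" "\<And>x y. x \<in> V \<Longrightarrow> y \<in> V \<Longrightarrow> (\<lambda>s. x s + y s) \<in> V"
    and "\<And>k x. k \<in> G 0 \<Longrightarrow> x \<in> V \<Longrightarrow> (\<lambda>s. k * x s) \<in> V" "V \<subseteq> kspan S"
  shows "\<exists>m g. is_basis V m g"
  using assms
proof (induction S arbitrary: V rule: finite_induct)
  case empty
  have "x = (\<lambda>s. 0)" if "x \<in> kspan {}" for x :: "'x \<Rightarrow> 'a"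
    using that by (cases rule: kspan.cases) auto
  then have "V = {\<lambda>s. 0}" using empty.prems(1,4) by blast
  then show ?case
    by (intro exI[of _ 0] exI[of _ "\<lambda>_ _. 0"]) (auto simp: is_basis_def intro!: exI[of _ "\<lambda>_. 0"])
next
  case (insert b F)
  note V = insert.prems(1-3)
  have "\<exists>m g. is_basis (V \<inter> kspan F) m g"
    by (rule insert.IH) (auto intro: V kspan_zero kspan_add kspan_mult)
  then obtain m g where mg: "is_basis (V \<inter> kspan F) m g" by blast
  show ?case
  proof (cases "V \<subseteq> kspan F")
    case True
    then show ?thesis using mg by (metis inf.absorb1)
  next
    case False
    then obtain x0 where x0: "x0 \<in> V" "x0 \<notin> kspan F" by blast
    then obtain k0 f0 where kf0: "k0 \<in> G 0" "f0 \<in> kspan F" "x0 = (\<lambda>s. k0 * b s + f0 s)"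
      using kspan_insert insert.prems(4) by blast
    have "k0 \<noteq> 0" using kf0 x0(2) by auto
    then obtain l0 where l0: "l0 \<in> G 0" "k0 * l0 = 1" using G_inv kf0(1) by blast
    let ?g = "\<lambda>j. if j = m then x0 else g j"
    have g: "\<And>j. g j \<in> V" "\<And>j. g j \<in> kspan F" using mg by (auto simp: is_basis_def)
    have sum_g: "(\<Sum>j<Suc m. k j * ?g j s) = (\<Sum>j<m. k j * g j s) + k m * x0 s" for k s
      by simp
    have "\<exists>k. (\<forall>j. k j \<in> G 0) \<and> x = (\<lambda>s. \<Sum>j<Suc m. k j * ?g j s)" if x: "x \<in> V" for x
    proof -
      obtain k f where kf: "k \<in> G 0" "f \<in> kspan F" "x = (\<lambda>s. k * b s + f s)"
        using kspan_insert insert.prems(4) x by blast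
      have "k * l0 * (k0 * b s) = k * b s" for s
        using l0(2) by (metis mult.assoc mult.commute mult_1)
      then have eq: "x s + (- (k * l0)) * x0 s = f s + (- (k * l0)) * f0 s" for s
        by (simp add: kf(3) kf0(3) distrib_left)
      have c: "- (k * l0) \<in> G 0" using kf l0 by auto
      have "(\<lambda>s. x s + (- (k * l0)) * x0 s) \<in> V" by (intro V x x0 c)
      moreover have "(\<lambda>s. x s + (- (k * l0)) * x0 s) \<in> kspan F"
        unfolding eq by (intro kspan_add kspan_mult kf kf0 c)
      ultimately obtain k' where k': "\<forall>j. k' j \<in> G 0"
        "(\<lambda>s. x s + (- (k * l0)) * x0 s) = (\<lambda>s. \<Sum>j<m. k' j * g j s)"
        using mg unfolding is_basis_def by blast
      have "x s = (\<Sum>j<Suc m. (if j = m then k * l0 else k' j) * ?g j s)" for s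
        unfolding sum_g using fun_cong[OF k'(2), of s] by (simp add: algebra_simps)
      then show ?thesis
        by (intro exI[of _ "\<lambda>j. if j = m then k * l0 else k' j"]) (use k' c kf l0 in auto)
    qed
    moreover have "\<forall>j<Suc m. k j = 0"
      if k: "\<forall>j. k j \<in> G 0" "\<forall>s. (\<Sum>j<Suc m. k j * ?g j s) = 0" for k
    proof -
      have km: "k m = 0"
      proof (rule ccontr)
        assume "k m \<noteq> 0"
        then obtain l where l: "l \<in> G 0" "k m * l = 1" using G_inv k(1) by blast
        have "x0 = (\<lambda>s. \<Sum>j<m. (- l * k j) * g j s)"
        proof
          fix s
          have "k m * x0 s = - (\<Sum>j<m. k j * g j s)"
            using k(2) unfolding sum_g by (simp add: add_eq_0_iff)
          then have "l * (k m * x0 s) = - l * (\<Sum>j<m. k j * g j s)" by simp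
          moreover have "l * (k m * x0 s) = x0 s"
            using l(2) by (metis mult.assoc mult.commute mult_1)
          ultimately show "x0 s = (\<Sum>j<m. (- l * k j) * g j s)"
            by (simp add: sum_distrib_left mult.assoc)
        qed
        moreover have "(\<lambda>s. \<Sum>j<m. (- l * k j) * g j s) \<in> kspan F"
          by (intro kspan_sum kspan_mult g G_mult0 G_minus l) (use k in auto)
        ultimately show False using x0(2) by metis
      qed
      then have "\<forall>s. (\<Sum>j<m. k j * g j s) = 0" using k(2) unfolding sum_g by simp
      then have "\<forall>j<m. k j = 0" using k(1) mg unfolding is_basis_def by blast
      with km show ?thesis by (simp add: less_Suc_eq)
    qed
    ultimately have "is_basis V (Suc m) ?g"
      using g(1) x0(1) unfolding is_basis_def by auto
    then show ?thesis by blast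
  qed
qed

text \<open>The degree \<open>e\<close> part of the relations among \<open>g 0, \<dots>, g (m - 1)\<close>, where each
  \<open>g k\<close> is given degree \<open>0\<close>.\<close>

definition syz :: "nat \<Rightarrow> (nat \<Rightarrow> 'x \<Rightarrow> 'a) \<Rightarrow> nat \<Rightarrow> (nat \<Rightarrow> 'a) set" where
  "syz m g e = {p. (\<forall>k. p k \<in> G e) \<and> (\<forall>k\<ge>m. p k = 0) \<and> (\<forall>s. (\<Sum>k<m. p k * g k s) = 0)}"

text \<open>Relations without a degree condition, as needed for the kernels and images of matrices;
  \<open>hcomp_rel\<close> passes from here to \<open>syz\<close>.\<close>

definition rel :: "nat \<Rightarrow> (nat \<Rightarrow> 'x \<Rightarrow> 'a) \<Rightarrow> (nat \<Rightarrow> 'a) set" where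
  "rel m g = {p \<in> vecs m. \<forall>s. (\<Sum>k<m. p k * g k s) = 0}"

lemma graded_module_syz: "graded_module (syz m g)"
proof -
  have "(\<Sum>k<m. (r * p k) * g k s) = r * (\<Sum>k<m. p k * g k s)" for r p s
    by (simp add: sum_distrib_left mult.assoc)
  then show ?thesis
    by (auto simp: graded_module_def syz_def distrib_right sum.distrib)
qed

text \<open>All entries of \<open>g\<close> have the same degree \<open>b\<close>, so the part of
  degree \<open>b + e\<close> of a relation involves only the parts of degree \<open>e\<close> of
  its coefficients.\<close>

lemma hcomp_rel:
  assumes "p \<in> rel m g" "\<And>k s. g k s \<in> G b"
  shows "(\<lambda>k. hcomp e (p k)) \<in> syz m g e"
proof -
  have "(\<Sum>k<m. hcomp e (p k) * g k s) = 0" for s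
  proof -
    have "(\<Sum>k<m. hcomp e (p k) * g k s) = hcomp (b + e) (\<Sum>k<m. p k * g k s)"
      by (simp add: hcomp_sum hcomp_mult_homog_shift'[OF assms(2)])
    also have "\<dots> = 0" using assms(1) by (simp add: rel_def)
    finally show ?thesis .
  qed
  then show ?thesis using assms(1) by (auto simp: syz_def rel_def vecs_def)
qed

text \<open>Passage from homogeneous elements to arbitrary ones: only finitely many degrees occur on
  the finite set \<open>X\<close>, and the coefficients found for these degrees are added
  up.\<close>

lemma span_of_hcomp:
  assumes "finite X" "\<And>s. s \<notin> X \<Longrightarrow> f s = 0" "\<And>s. s \<notin> X \<Longrightarrow> \<forall>k<m. g k s = 0"
    and "\<And>e. \<exists>p. (\<lambda>s. hcomp e (f s)) = (\<lambda>s. \<Sum>k<m. p k * g k s)"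
  shows "\<exists>p\<in>vecs m. f = (\<lambda>s. \<Sum>k<m. p k * g k s)"
proof -
  obtain P where P: "\<And>e. (\<lambda>s. hcomp e (f s)) = (\<lambda>s. \<Sum>k<m. P e k * g k s)"
    using assms(4) by metis
  obtain N where N: "\<And>s. s \<in> X \<Longrightarrow> f s = (\<Sum>e<N. hcomp e (f s))"
    using hcomp_common_decomp[OF assms(1), of f] by blast
  let ?p = "\<lambda>k. if k < m then \<Sum>e<N. P e k else 0"
  have "f s = (\<Sum>k<m. ?p k * g k s)" for s
  proof (cases "s \<in> X")
    case True
    have "f s = (\<Sum>e<N. \<Sum>k<m. P e k * g k s)" using N[OF True] fun_cong[OF P] by simp
    also have "\<dots> = (\<Sum>k<m. \<Sum>e<N. P e k * g k s)" by (rule sum.swap)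
    finally show ?thesis by (simp add: sum_distrib_right)
  next
    case False
    then show ?thesis using assms(2,3) by simp
  qed
  then show ?thesis by (intro bexI[of _ ?p]) (auto simp: vecs_def)
qed

end

section \<open>Linearity over a Koszul algebra\<close>

text \<open>The resolution of the residue field, augmented by the zero module: \<open>B 0 = 0\<close> and the map
  \<open>\<psi> 0\<close> into it make exactness at the last term \<open>R\<close> an instance of the general condition.\<close>

locale koszul_ring = graded_ring G
  for G :: "nat \<Rightarrow> 'a::comm_ring_1 set" +
  fixes B :: "nat \<Rightarrow> nat" and \<psi> :: "nat \<Rightarrow> nat \<Rightarrow> nat \<Rightarrow> 'a"
  assumes B_0: "B 0 = 0" and B_1: "B (Suc 0) = 1"
    and \<psi>_deg: "r < B i \<Longrightarrow> j < B (Suc i) \<Longrightarrow> \<psi> i r j \<in> G 1"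
    and \<psi>_complex: "r < B i \<Longrightarrow> l < B (Suc (Suc i)) \<Longrightarrow> (\<Sum>j<B (Suc i). \<psi> i r j * \<psi> (Suc i) j l) = 0"
    and \<psi>_exact: "(\<And>j. j < B (Suc i) \<Longrightarrow> x j \<in> G (Suc d)) \<Longrightarrow>
      (\<And>r. r < B i \<Longrightarrow> (\<Sum>j<B (Suc i). \<psi> i r j * x j) = 0) \<Longrightarrow>
      \<exists>y. (\<forall>l. y l \<in> G d) \<and> (\<forall>j<B (Suc i). x j = (\<Sum>l<B (Suc (Suc i)). \<psi> (Suc i) j l * y l))"
begin

text \<open>The differential of \<open>M \<otimes> P\<close> from term \<open>Suc i\<close> to term
  \<open>i\<close>, acting on tuples of elements of \<open>M\<close> that are given by their
  coordinates.\<close>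

definition app :: "nat \<Rightarrow> (nat \<Rightarrow> 'x \<Rightarrow> 'a) \<Rightarrow> nat \<Rightarrow> 'x \<Rightarrow> 'a" where
  "app i y r s = (\<Sum>j<B (Suc i). \<psi> i r j * y j s)"

lemma app_cong: "(\<And>j. j < B (Suc i) \<Longrightarrow> x j = y j) \<Longrightarrow> app i x r = app i y r"
  unfolding app_def by (rule ext, rule sum.cong) auto

text \<open>The reindexing \<open>\<sigma>\<close> serves two cases: it keeps \<open>s\<close> for
  combinations with the coefficients \<open>u j\<close>, and it picks the \<open>j\<close>-th
  coordinate when coefficient vectors are evaluated at generators \<open>g j\<close>.\<close>

lemma app_lincomb:
  "app i (\<lambda>k s. \<Sum>j\<in>J. a j s * y j k (\<sigma> j s)) r s = (\<Sum>j\<in>J. a j s * app i (y j) r (\<sigma> j s))"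
  unfolding app_def sum_distrib_left by (subst sum.swap) (simp add: mult.left_commute)

lemma app_diff: "app i (\<lambda>k s. x k s - y k s) r s = app i x r s - app i y r s"
  unfolding app_def by (simp add: right_diff_distrib sum_subtractf)

lemma app_app:
  assumes "r < B i"
  shows "app i (app (Suc i) y) r s = 0"
proof -
  have "app i (app (Suc i) y) r s
      = (\<Sum>j<B (Suc i). \<Sum>l<B (Suc (Suc i)). \<psi> i r j * (\<psi> (Suc i) j l * y l s))"
    by (simp add: app_def sum_distrib_left)
  also have "\<dots> = (\<Sum>l<B (Suc (Suc i)). (\<Sum>j<B (Suc i). \<psi> i r j * \<psi> (Suc i) j l) * y l s)"
    by (subst sum.swap) (simp add: sum_distrib_right mult.assoc)
  also have "\<dots> = 0" by (simp add: \<psi>_complex[OF assms])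
  finally show ?thesis .
qed

lemma app_mem:
  assumes "graded_module M" "\<And>k. k < B (Suc i) \<Longrightarrow> y k \<in> M d" "r < B i"
  shows "app i y r \<in> M (Suc d)"
proof -
  have "(\<lambda>s. \<Sum>j<B (Suc i). \<psi> i r j * y j s) \<in> M (1 + d)"
    by (rule graded_module_lincomb[OF assms(1)]) (use assms(2,3) \<psi>_deg in auto)
  then show ?thesis by (simp add: app_def[abs_def])
qed

text \<open>\<open>linear M a\<close> says that \<open>Tor\<^sub>i(M, K)\<close> vanishes in degrees above \<open>a + i\<close>, where \<open>Tor\<close> is
  computed from the resolution of \<open>K\<close>. It only involves the components \<open>M d\<close> with \<open>d \<ge> a\<close>, so
  truncating \<open>M\<close> has no effect.\<close>

definition linear :: "(nat \<Rightarrow> ('x \<Rightarrow> 'a) set) \<Rightarrow> nat \<Rightarrow> bool" where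
  "linear M a \<longleftrightarrow> (\<forall>i. \<forall>d\<ge>a. \<forall>x. (\<forall>j<B (Suc i). x j \<in> M (Suc d)) \<longrightarrow> (\<forall>r<B i. \<forall>s. app i x r s = 0) \<longrightarrow>
     (\<exists>y. (\<forall>k<B (Suc (Suc i)). y k \<in> M d) \<and> (\<forall>j<B (Suc i). x j = app (Suc i) y j)))"

lemma linearE:
  assumes "linear M a" "graded_module M" "d \<ge> a" "\<And>j. j < B (Suc i) \<Longrightarrow> x j \<in> M (Suc d)"
    "\<And>r s. r < B i \<Longrightarrow> app i x r s = 0"
  obtains y where "\<And>k. y k \<in> M d" "\<And>j. j < B (Suc i) \<Longrightarrow> x j = app (Suc i) y j"
proof -
  obtain y where y: "\<forall>k<B (Suc (Suc i)). y k \<in> M d" "\<forall>j<B (Suc i). x j = app (Suc i) y j"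
    using assms unfolding linear_def by blast
  let ?y = "\<lambda>k. if k < B (Suc (Suc i)) then y k else (\<lambda>s. 0)"
  have "app (Suc i) ?y j = app (Suc i) y j" for j by (rule app_cong) auto
  then show thesis using that[of ?y] y graded_module_zero[OF assms(2)] by auto
qed

text \<open>Exactness of \<open>P\<close>, used for each coordinate \<open>k\<close> separately. The
  last property, obtained by choosing 0 as the preimage of 0, keeps the support of the preimage
  inside that of \<open>x\<close>.\<close>

lemma exact_pointwise:
  assumes "\<And>j k. j < B (Suc i) \<Longrightarrow> x j k \<in> G (Suc d)" "\<And>r k. r < B i \<Longrightarrow> app i x r k = 0"
  obtains y where "\<And>l k. y l k \<in> G d" "\<And>j. j < B (Suc i) \<Longrightarrow> x j = app (Suc i) y j"
    "\<And>l k. (\<And>j. j < B (Suc i) \<Longrightarrow> x j k = 0) \<Longrightarrow> y l k = 0"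
proof -
  have "\<exists>y. (\<forall>l. y l \<in> G d) \<and> (\<forall>j<B (Suc i). x j k = (\<Sum>l<B (Suc (Suc i)). \<psi> (Suc i) j l * y l))" for k
    by (rule \<psi>_exact) (use assms in \<open>auto simp: app_def\<close>)
  then obtain Y where Y: "\<And>k l. Y k l \<in> G d"
    "\<And>k j. j < B (Suc i) \<Longrightarrow> x j k = (\<Sum>l<B (Suc (Suc i)). \<psi> (Suc i) j l * Y k l)"
    by metis
  let ?y = "\<lambda>l k. if \<forall>j<B (Suc i). x j k = 0 then 0 else Y k l"
  have y: "x j k = app (Suc i) ?y j k" if "j < B (Suc i)" for j k
  proof (cases "\<forall>j<B (Suc i). x j k = 0")
    case True
    then show ?thesis using that by (simp add: app_def)
  next
    case False
    then have "app (Suc i) ?y j k = (\<Sum>l<B (Suc (Suc i)). \<psi> (Suc i) j l * Y k l)"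
      by (simp only: app_def if_False)
    then show ?thesis using Y(2)[OF that, of k] by (rule trans[OF _ sym, rotated])
  qed
  show thesis
  proof (rule that[of ?y])
    show "x j = app (Suc i) ?y j" if "j < B (Suc i)" for j by (rule ext) (rule y[OF that])
  qed (use Y(1) in auto)
qed

lemma exists_gens: "x \<in> G (Suc d) \<Longrightarrow> \<exists>y. (\<forall>l. y l \<in> G d) \<and> x = (\<Sum>l<B 2. \<psi> 1 0 l * y l)"
  using \<psi>_exact[of 0 "\<lambda>_. x" d] by (simp add: B_0 B_1 numeral_2_eq_2)

lemma \<psi>_1_deg: "l < B 2 \<Longrightarrow> \<psi> 1 0 l \<in> G 1"
  using \<psi>_deg[of 0 1 l] by (simp add: B_1 numeral_2_eq_2)

text \<open>In degree 0 the indicator functions of the points of \<open>X\<close> span. Multiplying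
  a finite spanning set by the finitely many linear forms \<open>\<psi> 1 0 l\<close> gives one for
  the next degree.\<close>

lemma finite_dim:
  assumes "finite X"
  shows "\<exists>S. finite S \<and> {f. (\<forall>s. f s \<in> G e) \<and> (\<forall>s. s \<notin> X \<longrightarrow> f s = 0)} \<subseteq> kspan S"
proof (induction e)
  case 0
  let ?\<delta> = "\<lambda>s s'. if s' = s then 1 else (0::'a)"
  have "f \<in> kspan (?\<delta> ` X)" if f: "\<forall>s. f s \<in> G 0" "\<forall>s. s \<notin> X \<longrightarrow> f s = 0" for f
  proof -
    have "f s' = (\<Sum>s\<in>X. f s * ?\<delta> s s')" for s'
      using f(2) assms by (simp add: if_distrib cong: if_cong)
    then have "f = (\<lambda>s'. \<Sum>s\<in>X. f s * ?\<delta> s s')" by blast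
    moreover have "(\<lambda>s'. \<Sum>s\<in>X. f s * ?\<delta> s s') \<in> kspan (?\<delta> ` X)"
      by (intro kspan_sum kspan_mult kspan_base imageI) (use f in auto)
    ultimately show ?thesis by metis
  qed
  then show ?case using assms by (intro exI[of _ "?\<delta> ` X"]) auto
next
  case (Suc e)
  then obtain S where S: "finite S" "{f. (\<forall>s. f s \<in> G e) \<and> (\<forall>s. s \<notin> X \<longrightarrow> f s = 0)} \<subseteq> kspan S"
    by blast
  let ?T = "\<Union>l<B 2. (\<lambda>b s. \<psi> 1 0 l * b s) ` S"
  have mult: "(\<lambda>s. \<psi> 1 0 l * f s) \<in> kspan ?T" if "f \<in> kspan S" "l < B 2" for f l
    using that(1)
  proof (induction rule: kspan.induct)
    case (kspan_add_base b k x)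
    have "(\<lambda>s. \<psi> 1 0 l * b s) \<in> ?T" using kspan_add_base(1) that(2) by auto
    from kspan.kspan_add_base[OF this kspan_add_base(2) kspan_add_base.IH] show ?case
      by (simp add: algebra_simps)
  qed (simp add: kspan_zero)
  have "f \<in> kspan ?T" if f: "\<forall>s. f s \<in> G (Suc e)" "\<forall>s. s \<notin> X \<longrightarrow> f s = 0" for f
  proof -
    have "\<forall>s. \<exists>y. (\<forall>l. y l \<in> G e) \<and> f s = (\<Sum>l<B 2. \<psi> 1 0 l * y l)"
      using f(1) by (intro allI exists_gens) simp
    from choice[OF this] obtain y
      where y: "\<And>s l. y s l \<in> G e" "\<And>s. f s = (\<Sum>l<B 2. \<psi> 1 0 l * y s l)" by blast
    let ?y = "\<lambda>l s. if s \<in> X then y s l else 0"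
    have "?y l \<in> kspan S" for l using S(2) y(1) by auto
    then have "(\<lambda>s. \<Sum>l<B 2. \<psi> 1 0 l * ?y l s) \<in> kspan ?T"
      by (intro kspan_sum mult) auto
    moreover have "(\<Sum>l<B 2. \<psi> 1 0 l * ?y l s) = f s" for s
    proof (cases "s \<in> X")
      case True
      then show ?thesis using y(2)[of s] by (simp only: if_True)
    next
      case False
      then show ?thesis using f(2) by simp
    qed
    ultimately show ?thesis by simp
  qed
  then show ?case using S(1) by (intro exI[of _ ?T]) auto
qed

lemma homogeneous_basis:
  assumes "graded_module M" "finite X" "\<And>f s. f \<in> M e \<Longrightarrow> f s \<in> G b" "\<And>f s. f \<in> M e \<Longrightarrow> s \<notin> X \<Longrightarrow> f s = 0"
  shows "\<exists>m g. is_basis (M e) m g"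
proof -
  obtain S where S: "finite S" "{f. (\<forall>s. f s \<in> G b) \<and> (\<forall>s. s \<notin> X \<longrightarrow> f s = 0)} \<subseteq> kspan S"
    using finite_dim[OF assms(2), of b] by blast
  show ?thesis
  proof (rule exists_basis[OF S(1)])
    show "M e \<subseteq> kspan S" using S(2) assms(3,4) by blast
  qed (auto intro: graded_module_zero graded_module_add graded_module_mult0 assms(1))
qed

text \<open>The case \<open>i = 0\<close> of linearity says that \<open>M (Suc d)\<close> consists
  of sums of multiples of elements of \<open>M d\<close> by linear forms, for
  \<open>d \<ge> a\<close>. Iterated, this generates \<open>M (d + k)\<close> from
  \<open>G k\<close> and \<open>M d\<close>; the result is stated as an induction rule for additive
  sets \<open>P\<close>.\<close>

lemma linear_generated:
  assumes "linear M a" "graded_module M" "d \<ge> a" "x \<in> M (d + k)"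
    and "(\<lambda>s. 0) \<in> P" "\<And>x y. x \<in> P \<Longrightarrow> y \<in> P \<Longrightarrow> (\<lambda>s. x s + y s) \<in> P"
    and "\<And>r v. r \<in> G k \<Longrightarrow> v \<in> M d \<Longrightarrow> (\<lambda>s. r * v s) \<in> P"
  shows "x \<in> P"
  using assms(4-7)
proof (induction k arbitrary: P x)
  case 0
  then show ?case using "0.prems"(4)[of 1 x] by simp
next
  case (Suc k)
  obtain y where y: "\<And>l. y l \<in> M (d + k)" "\<And>j. j < B 1 \<Longrightarrow> x = app 1 y j"
    by (rule linearE[OF assms(1,2), of "d + k" 0 "\<lambda>_. x"])
      (use assms(3) Suc.prems(1) in \<open>auto simp: B_0\<close>)
  then have x: "x = (\<lambda>s. \<Sum>l<B 2. \<psi> 1 0 l * y l s)"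
    using B_1 by (auto simp: app_def[abs_def] numeral_2_eq_2)
  \<comment> \<open>Passing to the set of all \<open>z\<close> whose multiples by linear forms lie
    in \<open>P\<close> lowers \<open>k\<close> by one.\<close>
  have mem: "y l \<in> {z. \<forall>\<theta>\<in>G 1. (\<lambda>s. \<theta> * z s) \<in> P}" for l
  proof (rule Suc.IH[OF y(1)])
    show "(\<lambda>s. 0) \<in> {z. \<forall>\<theta>\<in>G 1. (\<lambda>s. \<theta> * z s) \<in> P}" using Suc.prems(2) by simp
    show "(\<lambda>s. v s + w s) \<in> {z. \<forall>\<theta>\<in>G 1. (\<lambda>s. \<theta> * z s) \<in> P}"
      if "v \<in> {z. \<forall>\<theta>\<in>G 1. (\<lambda>s. \<theta> * z s) \<in> P}" "w \<in> {z. \<forall>\<theta>\<in>G 1. (\<lambda>s. \<theta> * z s) \<in> P}" for v w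
      using that by (auto simp: distrib_left intro: Suc.prems(3))
    show "(\<lambda>s. r * v s) \<in> {z. \<forall>\<theta>\<in>G 1. (\<lambda>s. \<theta> * z s) \<in> P}" if "r \<in> G k" "v \<in> M d" for r v
      using Suc.prems(4)[OF G_mult1 that(2)] that(1) by (auto simp: mult.assoc)
  qed
  have "(\<lambda>s. \<Sum>l\<in>L. \<psi> 1 0 l * y l s) \<in> P" if "L \<subseteq> {..<B 2}" for L
    using that finite_subset[OF that finite_lessThan]
    by (induction L rule: infinite_finite_induct)
      (use mem \<psi>_1_deg in \<open>auto intro!: Suc.prems(2,3)\<close>)
  then show ?case unfolding x by blast
qed

text \<open>The \<open>u j\<close> span \<open>G c\<close> over the ground field, so factors from
  \<open>G c\<close> can be rewritten through them. This is the surjectivity of the multiplication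
  map on \<open>F \<otimes> M\<close> in degrees from \<open>a + c\<close> on.\<close>

lemma linear_span_power:
  assumes "linear M a" "graded_module M" "d \<ge> a" "x \<in> M (d + c)"
    and "\<And>r. r \<in> G c \<Longrightarrow> \<exists>k. (\<forall>j. k j \<in> G 0) \<and> r = (\<Sum>j<n. k j * u j)"
  shows "\<exists>v. (\<forall>j. v j \<in> M d) \<and> x = (\<lambda>s. \<Sum>j<n::nat. u j * v j s)"
proof -
  let ?P = "{x. \<exists>v. (\<forall>j. v j \<in> M d) \<and> x = (\<lambda>s. \<Sum>j<n. u j * v j s)}"
  have "x \<in> ?P"
  proof (rule linear_generated[OF assms(1-4)])
    show "(\<lambda>s. 0) \<in> ?P"
      using graded_module_zero[OF assms(2)] by (auto intro!: exI[of _ "\<lambda>_ _. 0"])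
    show "(\<lambda>s. x s + y s) \<in> ?P" if xy: "x \<in> ?P" "y \<in> ?P" for x y
    proof -
      obtain v w where "\<forall>j. v j \<in> M d" "x = (\<lambda>s. \<Sum>j<n. u j * v j s)"
        "\<forall>j. w j \<in> M d" "y = (\<lambda>s. \<Sum>j<n. u j * w j s)" using xy by blast
      then show ?thesis
        by (auto intro!: exI[of _ "\<lambda>j s. v j s + w j s"] graded_module_add[OF assms(2)]
            simp: distrib_left sum.distrib)
    qed
    show "(\<lambda>s. r * v s) \<in> ?P" if rv: "r \<in> G c" "v \<in> M d" for r v
    proof -
      obtain k where k: "\<forall>j. k j \<in> G 0" "r = (\<Sum>j<n. k j * u j)" using assms(5) rv(1) by blast
      have "r * v s = (\<Sum>j<n. u j * (k j * v s))" for s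
        unfolding k(2) sum_distrib_right by (rule sum.cong) (simp_all add: mult_ac)
      then show ?thesis
        using k(1) by (auto intro!: exI[of _ "\<lambda>j s. k j * v s"] graded_module_mult0[OF assms(2)] rv(2))
    qed
  qed
  then show ?thesis by blast
qed

lemma linear_span_basis:
  assumes "linear M a" "graded_module M" "x \<in> M (a + e)" "is_basis (M a) m g"
  shows "\<exists>p. (\<forall>k. p k \<in> G e) \<and> (\<forall>k\<ge>m. p k = 0) \<and> x = (\<lambda>s. \<Sum>k<m. p k * g k s)"
proof -
  let ?P = "{x. \<exists>p. (\<forall>k. p k \<in> G e) \<and> (\<forall>k\<ge>m. p k = 0) \<and> x = (\<lambda>s. \<Sum>k<m. p k * g k s)}"
  have "x \<in> ?P"
  proof (rule linear_generated[OF assms(1,2) order_refl assms(3)])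
    show "(\<lambda>s. 0) \<in> ?P" by (auto intro!: exI[of _ "\<lambda>_. 0"])
    show "(\<lambda>s. x s + y s) \<in> ?P" if xy: "x \<in> ?P" "y \<in> ?P" for x y
    proof -
      obtain p q where "\<forall>k. p k \<in> G e" "\<forall>k\<ge>m. p k = 0" "x = (\<lambda>s. \<Sum>k<m. p k * g k s)"
        "\<forall>k. q k \<in> G e" "\<forall>k\<ge>m. q k = 0" "y = (\<lambda>s. \<Sum>k<m. q k * g k s)" using xy by blast
      then show ?thesis
        by (auto intro!: exI[of _ "\<lambda>j. p j + q j"] simp: distrib_right sum.distrib)
    qed
    show "(\<lambda>s. r * v s) \<in> ?P" if rv: "r \<in> G e" "v \<in> M a" for r v
    proof -
      obtain k where k: "\<forall>j. k j \<in> G 0" "v = (\<lambda>s. \<Sum>j<m. k j * g j s)"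
        using assms(4) rv(2) unfolding is_basis_def by blast
      have "r * k j \<in> G e" for j using G_mult[of r e "k j" 0] rv(1) k(1) by simp
      moreover have "(\<lambda>s. r * v s) = (\<lambda>s. \<Sum>j<m. (if j < m then r * k j else 0) * g j s)"
        by (simp add: k(2) sum_distrib_left mult.assoc)
      ultimately show ?thesis by (auto intro!: exI[of _ "\<lambda>j. if j < m then r * k j else 0"])
    qed
  qed
  then show ?thesis by blast
qed

text \<open>The long exact sequence of \<open>0 \<rightarrow> syz \<rightarrow> R\<^sup>m \<rightarrow> M \<rightarrow> 0\<close>, as a diagram chase.\<close>

lemma linear_syz:
  assumes "linear M a" "graded_module M" "is_basis (M a) m g"
  shows "linear (syz m g) 1"
  unfolding linear_def
proof (intro allI impI)
  fix i d x
  assume d: "1 \<le> d" and x: "\<forall>j<B (Suc i). x j \<in> syz m g (Suc d)"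
    and x0: "\<forall>r<B i. \<forall>s. app i x r s = 0"
  \<comment> \<open>The bound 1 leaves room for \<open>e = d - 1\<close>, so that
    \<open>a + e\<close> is still in the range where \<open>M\<close> is linear.\<close>
  obtain e where e: "d = Suc e" using d by (cases d) auto
  obtain y where y: "\<And>l k. y l k \<in> G d" "\<And>j. j < B (Suc i) \<Longrightarrow> x j = app (Suc i) y j"
    "\<And>l k. (\<And>j. j < B (Suc i) \<Longrightarrow> x j k = 0) \<Longrightarrow> y l k = 0"
    by (rule exact_pointwise[of i x d]) (use x x0 in \<open>auto simp: syz_def\<close>)
  have ym: "y l k = 0" if "k \<ge> m" for l k
    using y(3) x that by (auto simp: syz_def)
  let ?\<eta> = "\<lambda>l s. \<Sum>k<m. g k s * y l k"
  have g: "g k \<in> M a" for k using assms(3) by (simp add: is_basis_def)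
  have \<eta>: "?\<eta> l \<in> M (Suc (a + e))" for l
    using graded_module_lincomb[OF assms(2), of "{..<m}" "y l" d g a] y(1) g
    by (simp add: e mult.commute add.commute)
  have app_\<eta>: "app i' (\<lambda>l s. \<Sum>k<m. g k s * z l k) r s = (\<Sum>k<m. g k s * app i' z r k)" for i' z r s
    using app_lincomb[of i' g "\<lambda>_. z" "\<lambda>k _. k" "{..<m}" r s] by simp
  \<comment> \<open>The image \<open>?\<eta>\<close> of \<open>y\<close> in \<open>M\<close> is a
    cycle: its boundary is the image of \<open>x\<close>, which is zero because \<open>x\<close>
    consists of relations.\<close>
  obtain w where w: "\<And>l. w l \<in> M (a + e)" "\<And>l. l < B (Suc (Suc i)) \<Longrightarrow> ?\<eta> l = app (Suc (Suc i)) w l"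
  proof (rule linearE[OF assms(1,2), of "a + e" "Suc i" ?\<eta>])
    show "app (Suc i) ?\<eta> r s = 0" if "r < B (Suc i)" for r s
      using x that unfolding app_\<eta> y(2)[OF that, symmetric] by (simp add: syz_def mult.commute)
  qed (use \<eta> in auto)
  obtain v where v: "\<And>l k. v l k \<in> G e" "\<And>l k. k \<ge> m \<Longrightarrow> v l k = 0"
    "\<And>l. w l = (\<lambda>s. \<Sum>k<m. v l k * g k s)"
    using linear_span_basis[OF assms(1,2) w(1) assms(3)] by metis
  \<comment> \<open>Subtracting the boundary of the lift \<open>v\<close> of \<open>w\<close> turns
    \<open>y\<close> into a tuple of relations; the boundary of the difference is still
    \<open>x\<close>.\<close>
  let ?y = "\<lambda>l k. y l k - app (Suc (Suc i)) v l k"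
  have "?y l \<in> syz m g d" if l: "l < B (Suc (Suc i))" for l
  proof -
    have "app (Suc (Suc i)) v l k \<in> G d" for k
      unfolding app_def e by (intro G_sum G_mult1 v(1) \<psi>_deg l) auto
    moreover have "app (Suc (Suc i)) v l k = 0" if "k \<ge> m" for k
      using v(2) that by (simp add: app_def)
    moreover have "(\<Sum>k<m. ?y l k * g k s) = 0" for s
    proof -
      have "w = (\<lambda>l s. \<Sum>k<m. g k s * v l k)"
        using v(3) by (intro ext) (simp add: mult.commute)
      then have "(\<Sum>k<m. g k s * app (Suc (Suc i)) v l k) = (\<Sum>k<m. g k s * y l k)"
        using fun_cong[OF w(2)[OF l], of s] app_\<eta>[of "Suc (Suc i)" v l s] by simp
      then show ?thesis by (simp add: right_diff_distrib sum_subtractf mult.commute)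
    qed
    ultimately show ?thesis using y(1) ym by (auto simp: syz_def)
  qed
  moreover have "x j = app (Suc i) ?y j" if "j < B (Suc i)" for j
    by (rule ext) (simp add: app_diff app_app[OF that] y(2)[OF that])
  ultimately show "\<exists>y. (\<forall>k<B (Suc (Suc i)). y k \<in> syz m g d) \<and> (\<forall>j<B (Suc i). x j = app (Suc i) y j)"
    by (intro exI[of _ ?y]) auto
qed

section \<open>Construction of linear resolutions\<close>

lemma syz_basis_zero:
  assumes "is_basis V m g"
  shows "syz m g 0 \<subseteq> {\<lambda>k. 0}"
proof
  fix p assume p: "p \<in> syz m g 0"
  then have "p k = 0" for k
    using assms by (cases "k < m") (auto simp: syz_def is_basis_def)
  then show "p \<in> {\<lambda>k. 0}" by auto
qed

text \<open>There are no relations of degree 0, those of degree 1 are spanned by \<open>h\<close>,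
  and linearity generates those of higher degree from degree 1. The basis elements are the columns
  of the matrix.\<close>

lemma rel_eq_mat_im:
  assumes "linear (syz m g) 1" "syz m g 0 \<subseteq> {\<lambda>k. 0}" "\<And>k s. g k s \<in> G b" "is_basis (syz m g 1) m' h"
  shows "rel m g = mat_im (\<lambda>r j. h j r) m m'"
proof
  have h: "h j \<in> syz m g 1" for j using assms(4) by (simp add: is_basis_def)
  have eq: "mat_app (\<lambda>r j. h j r) m m' q = (\<lambda>k. \<Sum>j<m'. q j * h j k)" for q
    using h by (auto simp: mat_app_def syz_def mult.commute)
  show "rel m g \<subseteq> mat_im (\<lambda>r j. h j r) m m'"
  proof
    fix p assume p: "p \<in> rel m g"
    have "\<exists>q\<in>vecs m'. p = (\<lambda>k. \<Sum>j<m'. q j * h j k)"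
    proof (rule span_of_hcomp[of "{..<m}"])
      fix e
      have e: "(\<lambda>k. hcomp e (p k)) \<in> syz m g e" by (rule hcomp_rel[OF p assms(3)])
      show "\<exists>q. (\<lambda>k. hcomp e (p k)) = (\<lambda>k. \<Sum>j<m'. q j * h j k)"
      proof (cases e)
        case 0
        then show ?thesis using e assms(2) by (intro exI[of _ "\<lambda>_. 0"]) auto
      next
        case (Suc e')
        then have "(\<lambda>k. hcomp e (p k)) \<in> syz m g (1 + e')" using e by simp
        from linear_span_basis[OF assms(1) graded_module_syz this assms(4)] show ?thesis by blast
      qed
    qed (use p h in \<open>auto simp: rel_def vecs_def syz_def\<close>)
    then show "p \<in> mat_im (\<lambda>r j. h j r) m m'" by (auto simp: mat_im_def eq)
  qed
  show "mat_im (\<lambda>r j. h j r) m m' \<subseteq> rel m g"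
  proof
    fix p assume "p \<in> mat_im (\<lambda>r j. h j r) m m'"
    then obtain q where p: "p = (\<lambda>k. \<Sum>j<m'. q j * h j k)" by (auto simp: mat_im_def eq)
    have "(\<Sum>k<m. p k * g k s) = 0" for s
    proof -
      have "(\<Sum>k<m. p k * g k s) = (\<Sum>j<m'. q j * (\<Sum>k<m. h j k * g k s))"
        unfolding p sum_distrib_right sum_distrib_left by (subst sum.swap) (simp add: mult.assoc)
      then show ?thesis using h by (simp add: syz_def)
    qed
    then show "p \<in> rel m g" using h by (auto simp: rel_def vecs_def p syz_def)
  qed
qed

text \<open>The assumptions hold again for \<open>m'\<close> and \<open>h\<close>, whose entries are
  linear forms, so that the step can be repeated indefinitely.\<close>

lemma syz_step:
  assumes "linear (syz m g) 1" "syz m g 0 \<subseteq> {\<lambda>k. 0}" "\<And>k s. g k s \<in> G b"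
  shows "\<exists>m' h. (\<forall>j. h j \<in> syz m g 1) \<and> rel m g = mat_im (\<lambda>r j. h j r) m m' \<and>
    linear (syz m' h) 1 \<and> syz m' h 0 \<subseteq> {\<lambda>k. 0}"
proof -
  have "\<exists>m' h. is_basis (syz m g 1) m' h"
    by (rule homogeneous_basis[OF graded_module_syz finite_lessThan[of m], where b = 1])
      (simp_all add: syz_def)
  then obtain m' h where h: "is_basis (syz m g 1) m' h" by blast
  then show ?thesis
    using rel_eq_mat_im[OF assms h] linear_syz[OF assms(1) graded_module_syz h] syz_basis_zero[OF h]
    by (intro exI[of _ m'] exI[of _ h]) (auto simp: is_basis_def)
qed

lemma linear_resolution:
  assumes "linear (syz m g) 1" "syz m g 0 \<subseteq> {\<lambda>k. 0}" "\<And>k s. g k s \<in> G b"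
  shows "\<exists>b \<phi>. b 0 = m \<and> rel m g = mat_im (\<phi> 0) (b 0) (b 1) \<and> linear_tail G b \<phi>"
proof -
  obtain m1 h1 where h1: "\<And>j. h1 j \<in> syz m g 1" "rel m g = mat_im (\<lambda>r j. h1 j r) m m1"
    "linear (syz m1 h1) 1" "syz m1 h1 0 \<subseteq> {\<lambda>k. 0}"
    using syz_step[OF assms] by metis
  \<comment> \<open>A state \<open>(p, q, h)\<close> stores a matrix of linear forms with
    \<open>p\<close> rows and the columns \<open>h 0, ..., h (q - 1)\<close>; the clause for
    \<open>i = 0\<close> fixes the first matrix. By \<open>Q\<close>, the columns of the next matrix
    generate the relations among the present columns.\<close>
  define P where "P = (\<lambda>(i::nat) (p, q, h). (i = 0 \<longrightarrow> (p, q, h) = (m, m1, h1)) \<and>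
    (\<forall>j r. h j r \<in> G 1) \<and> (\<forall>j. \<forall>r\<ge>p. h j r = 0) \<and> linear (syz q h) 1 \<and> syz q h 0 \<subseteq> {\<lambda>k. 0})"
  define Q where "Q = (\<lambda>(i::nat) (p::nat, q::nat, h::nat \<Rightarrow> nat \<Rightarrow> 'a) (p', q', h').
    p' = q \<and> rel q h = mat_im (\<lambda>r j. h' j r) q q')"
  have "\<exists>f. \<forall>i. P i (f i) \<and> Q i (f i) (f (Suc i))"
  proof (rule dependent_nat_choice)
    show "\<exists>x. P 0 x"
      by (rule exI[of _ "(m, m1, h1)"]) (use h1 in \<open>auto simp: P_def syz_def\<close>)
    fix x i assume "P i x"
    obtain p q h where x: "x = (p, q, h)" by (cases x)
    with \<open>P i x\<close> have h: "\<And>j r. h j r \<in> G 1" "linear (syz q h) 1" "syz q h 0 \<subseteq> {\<lambda>k. 0}"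
      by (auto simp: P_def)
    obtain q' h' where "\<And>j. h' j \<in> syz q h 1" "rel q h = mat_im (\<lambda>r j. h' j r) q q'"
      "linear (syz q' h') 1" "syz q' h' 0 \<subseteq> {\<lambda>k. 0}"
      using syz_step[OF h(2,3,1)] by metis
    then show "\<exists>y. P (Suc i) y \<and> Q i x y"
      by (intro exI[of _ "(q, q', h')"]) (auto simp: P_def Q_def x syz_def)
  qed
  then obtain f where f: "\<And>i. P i (f i)" "\<And>i. Q i (f i) (f (Suc i))" by blast
  define b where "b = (\<lambda>i. fst (f i))"
  define h where "h = (\<lambda>i. snd (snd (f i)))"
  have f_eq: "f i = (b i, b (Suc i), h i)" for i
    using f(2)[of i] by (cases "f i"; cases "f (Suc i)") (auto simp: Q_def b_def h_def)
  have h: "h i j r \<in> G 1" "r \<ge> b i \<Longrightarrow> h i j r = 0" for i j r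
    using f(1)[of i] by (auto simp: P_def f_eq)
  have start: "b 0 = m" "b 1 = m1" "h 0 = h1" using f(1)[of 0] by (auto simp: P_def f_eq)
  have "mat_ker (\<lambda>r j. h i j r) (b i) (b (Suc i)) = rel (b (Suc i)) (h i)" for i
  proof -
    have "mat_app (\<lambda>r j. h i j r) (b i) (b (Suc i)) x = (\<lambda>r. \<Sum>k<b (Suc i). x k * h i k r)" for x
      by (auto simp: mat_app_def h(2) mult.commute)
    then show ?thesis by (auto simp: mat_ker_def rel_def fun_eq_iff)
  qed
  moreover have "rel (b (Suc i)) (h i) = mat_im (\<lambda>r j. h (Suc i) j r) (b (Suc i)) (b (Suc (Suc i)))" for i
    using f(2)[of i] by (simp add: Q_def f_eq)
  ultimately have "linear_tail G b (\<lambda>i r j. h i j r)"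
    using h(1) by (simp add: linear_tail_def)
  then show ?thesis
    using h1(2) start by (intro exI[of _ b] exI[of _ "\<lambda>i r j. h i j r"]) simp
qed

end

text \<open>Exactness in the definition of \<open>koszul\<close> ignores degrees. Since the matrices
  are linear, replacing the entries of a preimage by their components of degree \<open>d\<close>
  gives the graded form in degree \<open>Suc d\<close>. Indices shift by one to make room for the
  augmentation.\<close>

lemma (in graded_ring) koszul_ringI:
  assumes "koszul G"
  shows "\<exists>B \<psi>. koszul_ring G B \<psi>"
proof -
  obtain b \<phi> where b: "b 0 = 1" "mat_im (\<phi> 0) 1 (b 1) = {x \<in> vecs 1. x 0 \<in> max_ideal G}"
    and tail: "linear_tail G b \<phi>"
    using assms unfolding koszul_def by blast
  have deg: "\<phi> i r j \<in> G 1" if "r < b i" "j < b (Suc i)" for i r j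
    using tail that by (auto simp: linear_tail_def)
  have ker: "mat_ker (\<phi> i) (b i) (b (Suc i)) = mat_im (\<phi> (Suc i)) (b (Suc i)) (b (Suc (Suc i)))" for i
    using tail by (auto simp: linear_tail_def)
  define B where "B = (\<lambda>i. case i of 0 \<Rightarrow> 0 | Suc i \<Rightarrow> b i)"
  define \<psi> where "\<psi> = (\<lambda>i. case i of 0 \<Rightarrow> (\<lambda>_ _. 0) | Suc i \<Rightarrow> \<phi> i)"
  have B: "B 0 = 0" "\<And>i. B (Suc i) = b i" by (auto simp: B_def)
  have \<psi>: "\<And>i. \<psi> (Suc i) = \<phi> i" by (auto simp: \<psi>_def)
  have degree: "\<exists>y. (\<forall>l. y l \<in> G d) \<and> (\<forall>j<b i. x j = (\<Sum>l<b (Suc i). \<phi> i j l * y l))"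
    if x: "\<And>j. j < b i \<Longrightarrow> x j \<in> G (Suc d)" and eq: "\<And>j. j < b i \<Longrightarrow> x j = mat_app (\<phi> i) (b i) (b (Suc i)) z j"
    for x z i d
  proof -
    have "x j = (\<Sum>l<b (Suc i). \<phi> i j l * hcomp d (z l))" if j: "j < b i" for j
    proof -
      have "x j = hcomp (1 + d) (x j)" using x[OF j] by (simp add: hcomp_homog)
      also have "\<dots> = (\<Sum>l<b (Suc i). hcomp (1 + d) (\<phi> i j l * z l))"
        using j by (simp add: eq mat_app_def hcomp_sum)
      also have "\<dots> = (\<Sum>l<b (Suc i). \<phi> i j l * hcomp d (z l))"
        by (intro sum.cong refl hcomp_mult_homog_shift deg j) auto
      finally show ?thesis .
    qed
    then show ?thesis by (intro exI[of _ "\<lambda>l. hcomp d (z l)"]) auto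
  qed
  have "koszul_ring G B \<psi>"
  proof unfold_locales
    show "B 0 = 0" "B (Suc 0) = 1" using b(1) by (auto simp: B)
    show "\<psi> i r j \<in> G 1" if "r < B i" "j < B (Suc i)" for i r j
      using that deg by (cases i) (auto simp: B \<psi>)
    show "(\<Sum>j<B (Suc i). \<psi> i r j * \<psi> (Suc i) j l) = 0" if "r < B i" "l < B (Suc (Suc i))" for i r l
    proof (cases i)
      case 0
      then show ?thesis using that B by simp
    next
      case (Suc i')
      \<comment> \<open>The unit vector \<open>?e\<close> extracts column \<open>l\<close> of
        \<open>\<phi> i\<close>, which therefore lies in the kernel of
        \<open>\<phi> i'\<close>.\<close>
      let ?e = "\<lambda>k. if k = l then 1 else (0::'a)"
      have "mat_app (\<phi> i) (b i) (b (Suc i)) ?e \<in> mat_ker (\<phi> i') (b i') (b (Suc i'))"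
        using that unfolding ker Suc mat_im_def by (intro imageI) (auto simp: vecs_def B)
      then have "mat_app (\<phi> i') (b i') (b (Suc i')) (mat_app (\<phi> i) (b i) (b (Suc i)) ?e) r = 0"
        by (simp add: mat_ker_def)
      moreover have "mat_app (\<phi> i) (b i) (b (Suc i)) ?e j = \<phi> i j l" if "j < b i" for j
        using that \<open>l < B (Suc (Suc i))\<close> by (simp add: mat_app_def B if_distrib cong: if_cong)
      ultimately show ?thesis using that(1) by (simp add: Suc B \<psi> mat_app_def)
    qed
    show "\<exists>y. (\<forall>l. y l \<in> G d) \<and> (\<forall>j<B (Suc i). x j = (\<Sum>l<B (Suc (Suc i)). \<psi> (Suc i) j l * y l))"
      if x: "\<And>j. j < B (Suc i) \<Longrightarrow> x j \<in> G (Suc d)"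
        and x0: "\<And>r. r < B i \<Longrightarrow> (\<Sum>j<B (Suc i). \<psi> i r j * x j) = 0" for i x d
    proof -
      let ?x = "\<lambda>j. if j < b i then x j else 0"
      have "?x \<in> mat_im (\<phi> i) (b i) (b (Suc i))"
      proof (cases i)
        \<comment> \<open>Positive degree puts \<open>x 0\<close> into the maximal ideal, the image
          of \<open>\<phi> 0\<close>.\<close>
        case 0
        then show ?thesis
          using x[of 0] G_subset_max_ideal[of d] b B by (auto simp: vecs_def)
      next
        case (Suc i')
        have "?x \<in> mat_ker (\<phi> i') (b i') (b (Suc i'))"
          using x0 by (auto simp: mat_ker_def vecs_def mat_app_def Suc B \<psi>)
        then show ?thesis using ker Suc by simp
      qed
      then obtain z where z: "?x = mat_app (\<phi> i) (b i) (b (Suc i)) z" by (auto simp: mat_im_def)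
      have "x j = mat_app (\<phi> i) (b i) (b (Suc i)) z j" if "j < b i" for j
        using fun_cong[OF z, of j] that by simp
      from degree[OF _ this, of d] show ?thesis using x by (simp add: B \<psi>)
    qed
  qed
  then show ?thesis by blast
qed

section \<open>The exterior algebra and Koszul cycles\<close>

text \<open>\<open>prepend j f\<close> is \<open>e\<^sub>j \<and> f\<close>, and \<open>contract j\<close> is the contraction with the dual of \<open>e\<^sub>j\<close>.\<close>

definition pos_sign :: "nat \<Rightarrow> nat set \<Rightarrow> 'a::comm_ring_1" where
  "pos_sign j T = (-1) ^ card {k\<in>T. k < j}"

definition contract :: "nat \<Rightarrow> (nat set \<Rightarrow> 'a::comm_ring_1) \<Rightarrow> nat set \<Rightarrow> 'a" where
  "contract j f T = (if j \<in> T then 0 else pos_sign j T * f (insert j T))"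

definition prepend :: "nat \<Rightarrow> (nat set \<Rightarrow> 'a::comm_ring_1) \<Rightarrow> nat set \<Rightarrow> 'a" where
  "prepend j f S = (if j \<in> S then pos_sign j S * f (S - {j}) else 0)"

text \<open>Contraction with the linear form that takes \<open>e\<^sub>j\<close> to
  \<open>u j\<close>. Unlike in \<open>kdiff\<close>, no condition on \<open>T\<close> intervenes,
  so identities for contractions carry over directly; both agree on exterior powers.\<close>

definition koszul_diff :: "nat \<Rightarrow> (nat \<Rightarrow> 'a::comm_ring_1) \<Rightarrow> (nat set \<Rightarrow> 'a) \<Rightarrow> nat set \<Rightarrow> 'a" where
  "koszul_diff n u f T = (\<Sum>j<n. u j * contract j f T)"

section \<open>Signs and anticommutation rules\<close>

lemma pos_sign_insert:
  assumes "i \<notin> T"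
  shows "pos_sign j (insert i T) = (if i < j then - pos_sign j T else pos_sign j T)"
proof -
  have "{k \<in> insert i T. k < j} = (if i < j then insert i {k\<in>T. k < j} else {k\<in>T. k < j})"
    by auto
  moreover have "finite {k\<in>T. k < j}" by (rule finite_subset[of _ "{..<j}"]) auto
  ultimately show ?thesis using assms by (simp add: pos_sign_def)
qed

lemma pos_sign_remove: "i \<in> T \<Longrightarrow> pos_sign j T = (if i < j then - pos_sign j (T - {i}) else pos_sign j (T - {i}))"
  using pos_sign_insert[of i "T - {i}" j] by (simp add: insert_absorb)

lemma pos_sign_cancel: "pos_sign j T * (pos_sign j T * x) = x"
  by (simp add: pos_sign_def mult.assoc[symmetric] flip: power_mult_distrib)

text \<open>The Clifford relation between exterior multiplication and contraction: contraction is an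
  antiderivation.\<close>

lemma contract_prepend:
  "contract i (prepend j f) T = (if i = j then f T else 0) - prepend j (contract i f) T"
proof (cases "i = j")
  case True
  then show ?thesis
    by (auto simp: pos_sign_cancel contract_def prepend_def pos_sign_insert
        pos_sign_remove[of j T j] insert_absorb)
next
  case False
  then show ?thesis
    by (cases "i < j"; cases "i \<in> T"; cases "j \<in> T")
      (auto simp: contract_def prepend_def pos_sign_insert pos_sign_remove[of j T] insert_Diff_if
        mult.left_commute)
qed

lemma contract_contract: "contract i (contract j f) T = - contract j (contract i f) T"
  by (cases i j rule: linorder_cases)
    (auto simp: contract_def pos_sign_insert insert_commute mult.left_commute)

lemma prepend_contract: "prepend j (contract j f) S = (if j \<in> S then f S else 0)"
  by (auto simp: contract_def prepend_def insert_absorb pos_sign_cancel pos_sign_remove[of j S j])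

lemma contract_zero [simp]: "contract j (\<lambda>S. 0) = (\<lambda>T. 0)"
  by (auto simp: contract_def)

lemma prepend_zero [simp]: "prepend j (\<lambda>S. 0) = (\<lambda>T. 0)"
  by (auto simp: prepend_def)

lemma contract_sum: "contract i (\<lambda>S. \<Sum>j\<in>J. f j S) T = (\<Sum>j\<in>J. contract i (f j) T)"
  by (simp add: contract_def sum_distrib_left)

lemma contract_mult: "contract i (\<lambda>S. r * f S) T = r * contract i f T"
  by (simp add: contract_def mult.left_commute)

lemma prepend_sum: "prepend i (\<lambda>S. \<Sum>j\<in>J. f j S) T = (\<Sum>j\<in>J. prepend i (f j) T)"
  by (simp add: prepend_def sum_distrib_left)

lemma prepend_mult: "prepend i (\<lambda>S. r * f S) T = r * prepend i f T"
  by (simp add: prepend_def mult.left_commute)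

lemma koszul_diff_sum: "koszul_diff n u (\<lambda>S. \<Sum>j\<in>J. f j S) T = (\<Sum>j\<in>J. koszul_diff n u (f j) T)"
  unfolding koszul_diff_def contract_sum sum_distrib_left by (rule sum.swap)

lemma koszul_diff_mult: "koszul_diff n u (\<lambda>S. r * f S) T = r * koszul_diff n u f T"
  by (simp add: koszul_diff_def contract_mult sum_distrib_left mult.left_commute)

lemma koszul_diff_add: "koszul_diff n u (\<lambda>S. f S + g S) T = koszul_diff n u f T + koszul_diff n u g T"
  by (simp add: koszul_diff_def contract_def sum.distrib[symmetric] distrib_left if_distrib cong: if_cong)

lemma koszul_diff_contract: "koszul_diff n u (contract i f) T = - contract i (koszul_diff n u f) T"
  unfolding koszul_diff_def contract_sum contract_mult
  by (simp add: contract_contract[of _ i] sum_negf)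

text \<open>The Leibniz rule for the product with \<open>e\<^sub>j\<close>, whose differential is
  \<open>u j\<close>.\<close>

lemma koszul_diff_prepend:
  assumes "j < n"
  shows "koszul_diff n u (prepend j f) T = u j * f T - prepend j (koszul_diff n u f) T"
proof -
  have "koszul_diff n u (prepend j f) T = (\<Sum>i<n. (if i = j then u j * f T else 0) - u i * prepend j (contract i f) T)"
    unfolding koszul_diff_def contract_prepend by (rule sum.cong) (auto simp: right_diff_distrib)
  also have "\<dots> = u j * f T - prepend j (koszul_diff n u f) T"
    using assms by (simp add: sum_subtractf koszul_diff_def[abs_def] prepend_sum prepend_mult)
  finally show ?thesis .
qed

section \<open>Exterior powers and cycles\<close>

lemma wedge_pow_contract: "f \<in> wedge_pow n (Suc s) \<Longrightarrow> contract j f \<in> wedge_pow n s"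
  unfolding wedge_pow_def
proof (intro CollectI allI impI)
  fix T assume f: "f \<in> {x. \<forall>S. x S \<noteq> 0 \<longrightarrow> S \<subseteq> {..<n} \<and> card S = Suc s}" and "contract j f T \<noteq> 0"
  then have "j \<notin> T" "f (insert j T) \<noteq> 0" by (auto simp: contract_def split: if_splits)
  then have T: "j \<notin> T" "insert j T \<subseteq> {..<n}" "card (insert j T) = Suc s" using f by auto
  then have "finite T" by (meson finite_lessThan finite_subset finite_insert)
  then show "T \<subseteq> {..<n} \<and> card T = s" using T by simp
qed

lemma wedge_pow_prepend: "f \<in> wedge_pow n s \<Longrightarrow> j < n \<Longrightarrow> prepend j f \<in> wedge_pow n (Suc s)"
  unfolding wedge_pow_def
proof (intro CollectI allI impI)
  fix S assume f: "f \<in> {x. \<forall>S. x S \<noteq> 0 \<longrightarrow> S \<subseteq> {..<n} \<and> card S = s}" and j: "j < n"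
    and "prepend j f S \<noteq> 0"
  then have "j \<in> S" "f (S - {j}) \<noteq> 0" by (auto simp: prepend_def split: if_splits)
  then have S: "j \<in> S" "S - {j} \<subseteq> {..<n}" "card (S - {j}) = s" using f by auto
  then have "finite (S - {j})" by (meson finite_lessThan finite_subset)
  then have "card S = Suc s" using S by (metis card_Suc_Diff1 finite_Diff2 finite.emptyI finite_insert)
  then show "S \<subseteq> {..<n} \<and> card S = Suc s" using S(2) j by auto
qed

lemma wedge_pow_zero: "(\<lambda>S. 0) \<in> wedge_pow n s"
  and wedge_pow_add: "f \<in> wedge_pow n s \<Longrightarrow> g \<in> wedge_pow n s \<Longrightarrow> (\<lambda>S. f S + g S) \<in> wedge_pow n s"
  and wedge_pow_mult: "f \<in> wedge_pow n s \<Longrightarrow> (\<lambda>S. r * f S) \<in> wedge_pow n s"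
  unfolding wedge_pow_def mem_Collect_eq by (simp, metis add_0, metis mult_zero_right)

lemma kdiff_eq_koszul_diff:
  assumes "f \<in> wedge_pow n s"
  shows "kdiff n u f = koszul_diff n u f"
proof
  fix T
  show "kdiff n u f T = koszul_diff n u f T"
  proof (cases "T \<subseteq> {..<n}")
    case True
    have "koszul_diff n u f T = (\<Sum>j\<in>{..<n} - T. u j * contract j f T)"
      unfolding koszul_diff_def by (rule sum.mono_neutral_right) (auto simp: contract_def)
    then show ?thesis using True by (simp add: kdiff_def contract_def pos_sign_def mult_ac)
  next
    case False
    then have "f (insert j T) = 0" for j using assms by (auto simp: wedge_pow_def)
    then have "contract j f T = 0" for j by (simp add: contract_def)
    then show ?thesis using False by (simp add: kdiff_def koszul_diff_def)
  qed
qed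

lemma cycles_iff: "f \<in> cycles n u s \<longleftrightarrow> f \<in> wedge_pow n s \<and> (\<forall>T. koszul_diff n u f T = 0)"
  by (auto simp: cycles_def kdiff_eq_koszul_diff fun_eq_iff)

lemma cycles_zero: "(\<lambda>S. 0) \<in> cycles n u s"
  by (simp add: cycles_iff wedge_pow_zero koszul_diff_def)

lemma cycles_add: "f \<in> cycles n u s \<Longrightarrow> g \<in> cycles n u s \<Longrightarrow> (\<lambda>S. f S + g S) \<in> cycles n u s"
  by (simp add: cycles_iff wedge_pow_add koszul_diff_add)

lemma cycles_mult: "f \<in> cycles n u s \<Longrightarrow> (\<lambda>S. r * f S) \<in> cycles n u s"
  by (simp add: cycles_iff wedge_pow_mult koszul_diff_mult)

lemma cycles_contract: "f \<in> cycles n u (Suc s) \<Longrightarrow> contract j f \<in> cycles n u s"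
  using koszul_diff_contract[of n u j f] by (auto simp: cycles_iff wedge_pow_contract contract_def)

lemma wedge_pow_sum: "(\<And>j. j \<in> J \<Longrightarrow> f j \<in> wedge_pow n s) \<Longrightarrow> (\<lambda>S. \<Sum>j\<in>J. f j S) \<in> wedge_pow n s"
  by (induction J rule: infinite_finite_induct) (auto intro: wedge_pow_zero wedge_pow_add)

text \<open>Since each \<open>y j\<close> is a cycle, the Leibniz rule leaves
  \<open>\<Sum>j<n. u j * y j T\<close> as the differential of the sum.\<close>

lemma cycles_prepend:
  assumes "\<And>j. j < n \<Longrightarrow> y j \<in> cycles n u s" "\<And>T. (\<Sum>j<n. u j * y j T) = 0"
  shows "(\<lambda>S. \<Sum>j<n. prepend j (y j) S) \<in> cycles n u (Suc s)"
proof -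
  have "koszul_diff n u (\<lambda>S. \<Sum>j<n. prepend j (y j) S) T = (\<Sum>j<n. u j * y j T)" for T
    unfolding koszul_diff_sum
  proof (rule sum.cong)
    fix j assume j: "j \<in> {..<n}"
    then have "koszul_diff n u (y j) = (\<lambda>T. 0)" using assms(1) by (auto simp: cycles_iff)
    then show "koszul_diff n u (prepend j (y j)) T = u j * y j T" using j by (simp add: koszul_diff_prepend)
  qed simp
  then show ?thesis
    using assms by (auto simp: cycles_iff intro!: wedge_pow_sum wedge_pow_prepend)
qed

text \<open>Euler's formula: contracting by \<open>j\<close> and then multiplying by
  \<open>e\<^sub>j\<close> keeps exactly the basis elements \<open>e\<^sub>S\<close> with
  \<open>j\<close> in \<open>S\<close>, so \<open>e\<^sub>S\<close> is counted once for each of its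
  \<open>s\<close> indices.\<close>

lemma prepend_contract_sum:
  assumes "f \<in> wedge_pow n s"
  shows "(\<Sum>j<n. prepend j (contract j f) S) = of_nat s * f S"
proof (cases "f S = 0")
  case False
  then have "S \<subseteq> {..<n}" "card S = s" using assms by (auto simp: wedge_pow_def)
  then show ?thesis by (simp add: prepend_contract sum.If_cases Int_absorb1 Collect_mem_eq)
qed (simp add: prepend_contract cong: if_cong)

text \<open>Only singletons \<open>A = {j}\<close> contribute, and the inversions between
  \<open>{j}\<close> and \<open>S - {j}\<close> are the elements of \<open>S\<close> below
  \<open>j\<close>, so the signs of \<open>wedge\<close> and \<open>prepend\<close> agree.\<close>

lemma wedge_one_left:
  assumes "z \<in> wedge_pow n 1" "g \<in> wedge_pow n s"
  shows "wedge z g S = (\<Sum>j<n. z {j} * prepend j g S)"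
proof (cases "finite S")
  case True
  let ?F = "\<lambda>A. (-1) ^ card {(a, b). a \<in> A \<and> b \<in> S - A \<and> b < a} * z A * g (S - A)"
  have "wedge z g S = (\<Sum>A\<in>Pow S. ?F A)" using True by (simp add: wedge_def)
  also have "\<dots> = (\<Sum>A\<in>(\<lambda>j. {j}) ` (S \<inter> {..<n}). ?F A)"
  proof (rule sum.mono_neutral_right)
    show "\<forall>A\<in>Pow S - (\<lambda>j. {j}) ` (S \<inter> {..<n}). ?F A = 0"
    proof
      fix A assume A: "A \<in> Pow S - (\<lambda>j. {j}) ` (S \<inter> {..<n})"
      have "z A = 0"
      proof (rule ccontr)
        assume "z A \<noteq> 0"
        then have "A \<subseteq> {..<n}" "card A = 1" using assms(1) by (auto simp: wedge_pow_def)
        then show False using A by (auto simp: card_1_singleton_iff)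
      qed
      then show "?F A = 0" by simp
    qed
  qed (use True in auto)
  also have "\<dots> = (\<Sum>j\<in>S \<inter> {..<n}. ?F {j})" by (simp add: sum.reindex)
  also have "\<dots> = (\<Sum>j\<in>S \<inter> {..<n}. z {j} * prepend j g S)"
  proof (rule sum.cong)
    fix j assume j: "j \<in> S \<inter> {..<n}"
    have "{(a, b). a \<in> {j} \<and> b \<in> S - {j} \<and> b < a} = Pair j ` {k\<in>S. k < j}" by auto
    then have "card {(a, b). a \<in> {j} \<and> b \<in> S - {j} \<and> b < a} = card {k\<in>S. k < j}"
      by (simp add: card_image inj_on_def)
    then show "?F {j} = z {j} * prepend j g S"
      using j by (simp add: prepend_def pos_sign_def mult_ac)
  qed simp
  also have "\<dots> = (\<Sum>j<n. z {j} * prepend j g S)"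
    by (rule sum.mono_neutral_left) (auto simp: prepend_def)
  finally show ?thesis .
next
  case False
  have "g (S - {j}) = 0" for j
  proof (rule ccontr)
    assume "g (S - {j}) \<noteq> 0"
    then have "S - {j} \<subseteq> {..<n}" using assms(2) unfolding wedge_pow_def by blast
    then have "finite (S - {j})" by (rule finite_subset) simp
    then show False using False by simp
  qed
  then have "prepend j g S = 0" for j by (simp add: prepend_def)
  then show ?thesis using False by (simp add: wedge_def)
qed

section \<open>Spans over the ring and products of 1-cycles\<close>

lemma rspan_zero: "(\<lambda>S. 0) \<in> rspan V"
  unfolding rspan_def by (auto intro!: exI[of _ "[]"])

lemma rspan_add_base: "v \<in> V \<Longrightarrow> x \<in> rspan V \<Longrightarrow> (\<lambda>S. r * v S + x S) \<in> rspan V"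
  unfolding rspan_def by clarify (rule_tac x = "(r, v) # l" in exI, auto)

lemma rspan_induct [consumes 1, case_names zero add]:
  assumes "x \<in> rspan V" "P (\<lambda>S. 0)"
    "\<And>r v x. v \<in> V \<Longrightarrow> x \<in> rspan V \<Longrightarrow> P x \<Longrightarrow> P (\<lambda>S. r * v S + x S)"
  shows "P x"
proof -
  obtain l where l: "set (map snd l) \<subseteq> V" "x = (\<lambda>S. sum_list (map (\<lambda>(r, v). r * v S) l))"
    using assms(1) unfolding rspan_def by blast
  let ?s = "\<lambda>l S. sum_list (map (\<lambda>(r, v). r * v S) l)"
  have "?s l \<in> rspan V \<and> P (?s l)"
    using l(1)
  proof (induction l)
    case Nil
    then show ?case using assms(2) rspan_zero by simp
  next
    case (Cons p l)
    obtain r v where p: "p = (r, v)" by (cases p)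
    then have "v \<in> V" "?s l \<in> rspan V" "P (?s l)" using Cons by auto
    then have "(\<lambda>S. r * v S + ?s l S) \<in> rspan V \<and> P (\<lambda>S. r * v S + ?s l S)"
      using assms(3) rspan_add_base by blast
    then show ?case by (simp add: p)
  qed
  then show ?thesis using l(2) by simp
qed

lemma rspan_base: "v \<in> V \<Longrightarrow> v \<in> rspan V"
  using rspan_add_base[OF _ rspan_zero, of v V 1] by simp

lemma rspan_add:
  assumes "x \<in> rspan V" "y \<in> rspan V"
  shows "(\<lambda>S. x S + y S) \<in> rspan V"
  using assms
proof (induction x rule: rspan_induct)
  case (add r v x)
  then show ?case using rspan_add_base[of v V "\<lambda>S. x S + y S" r] by (simp add: add.assoc)
qed simp

lemma rspan_mult:
  assumes "x \<in> rspan V"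
  shows "(\<lambda>S. a * x S) \<in> rspan V"
  using assms
proof (induction x rule: rspan_induct)
  case (add r v x)
  then show ?case
    using rspan_add_base[of v V "\<lambda>S. a * x S" "a * r"] by (simp add: distrib_left mult.assoc)
qed (simp add: rspan_zero)

lemma rspan_sum: "(\<And>j. j \<in> J \<Longrightarrow> x j \<in> rspan V) \<Longrightarrow> (\<lambda>S. \<Sum>j\<in>J. x j S) \<in> rspan V"
  by (induction J rule: infinite_finite_induct) (auto intro: rspan_zero rspan_add)

lemma cycles1_pow_wedge:
  assumes "z \<in> cycles n u 1" "y \<in> cycles1_pow n u t"
  shows "wedge z y \<in> cycles1_pow n u (Suc t)"
  using assms(2) unfolding cycles1_pow_def
proof (induction y rule: rspan_induct)
  case zero
  have "wedge z (\<lambda>S. 0) = (\<lambda>S. 0)" by (auto simp: wedge_def)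
  then show ?case by (simp add: rspan_zero)
next
  case (add r v y)
  then obtain zs where zs: "v = foldr wedge zs ext_one" "length zs = t" "set zs \<subseteq> cycles n u 1" by blast
  have "wedge z (\<lambda>S. r * v S + y S) S = r * wedge z v S + wedge z y S" for S
    unfolding wedge_def sum_distrib_left
    by (cases "finite S")
      (simp_all only: if_True if_False distrib_left sum.distrib sum_distrib_left mult.left_commute[of r]
        mult_zero_right add_0)
  then have "wedge z (\<lambda>S. r * v S + y S) = (\<lambda>S. r * wedge z v S + wedge z y S)" by blast
  moreover have "wedge z v \<in> {foldr wedge zs ext_one |zs. length zs = Suc t \<and> set zs \<subseteq> cycles n u 1}"
    using zs assms(1) by (auto intro!: exI[of _ "z # zs"])
  ultimately show ?case using rspan_add_base[OF _ add.IH] by simp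
qed

text \<open>The differential of an element of \<open>F\<close> can be nonzero only at the empty set,
  where it is the given sum.\<close>

lemma cycles_1I:
  assumes "(\<Sum>j<n. u j * a j) = 0"
  shows "(\<lambda>S. \<Sum>j<n. if S = {j} then a j else 0) \<in> cycles n u 1"
proof -
  let ?z = "\<lambda>S. \<Sum>j<n. if S = {j} then a j else 0"
  have supp: "\<exists>j<n. S = {j}" if "?z S \<noteq> 0" for S
  proof (rule ccontr)
    assume "\<not> (\<exists>j<n. S = {j})"
    then have "?z S = 0" by (intro sum.neutral) auto
    then show False using that by simp
  qed
  have val: "?z {j} = a j" if "j < n" for j
    using that by (simp add: eq_commute[of "{j}"])
  have "koszul_diff n u ?z T = 0" for T
  proof (cases "T = {}")
    case True
    have "koszul_diff n u ?z {} = (\<Sum>j<n. u j * ?z {j})" by (simp only: koszul_diff_def contract_def pos_sign_def) simp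
    also have "\<dots> = 0" using val assms by simp
    finally show ?thesis using True by simp
  next
    case False
    have "contract j ?z T = 0" for j
    proof (cases "j \<in> T")
      case False
      then have "insert j T \<noteq> {i}" for i using \<open>T \<noteq> {}\<close> by auto
      then have "?z (insert j T) = 0" by (simp only: if_False sum.neutral_const)
      then show ?thesis by (simp only: contract_def mult_zero_right if_cancel)
    qed (simp add: contract_def)
    then show ?thesis by (simp add: koszul_diff_def)
  qed
  moreover have "?z \<in> wedge_pow n 1"
    unfolding wedge_pow_def
  proof (intro CollectI allI impI)
    fix S assume "?z S \<noteq> 0"
    from supp[OF this] show "S \<subseteq> {..<n} \<and> card S = 1" by auto
  qed
  ultimately show ?thesis by (simp add: cycles_iff)
qed

lemma cycles_1D:
  assumes "z \<in> cycles n u 1"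
  shows "(\<Sum>j<n. u j * z {j}) = 0"
proof -
  have "koszul_diff n u z {} = 0" using assms by (simp add: cycles_iff)
  then show ?thesis by (simp add: koszul_diff_def contract_def pos_sign_def)
qed

section \<open>Linearity of the modules of cycles\<close>

context koszul_ring
begin

text \<open>Basis elements have degree 0 here: \<open>e\<close> stands for the degree
  \<open>e + t * c\<close> in the grading where each \<open>e\<^sub>j\<close> has degree
  \<open>c\<close>.\<close>

definition cycles_deg :: "nat \<Rightarrow> (nat \<Rightarrow> 'a) \<Rightarrow> nat \<Rightarrow> nat \<Rightarrow> (nat set \<Rightarrow> 'a) set" where
  "cycles_deg n u t e = {f \<in> cycles n u t. \<forall>S. f S \<in> G e}"

lemma graded_module_cycles_deg: "graded_module (cycles_deg n u t)"
  by (auto simp: graded_module_def cycles_deg_def intro: cycles_zero cycles_add cycles_mult)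

lemma pos_sign_mem: "pos_sign j T \<in> G 0"
  by (simp add: pos_sign_def)

lemma contract_mem: "(\<And>S. f S \<in> G e) \<Longrightarrow> contract j f T \<in> G e"
  by (auto simp: contract_def intro: G_mult0 pos_sign_mem)

lemma prepend_mem: "(\<And>S. f S \<in> G e) \<Longrightarrow> prepend j f T \<in> G e"
  by (auto simp: prepend_def intro: G_mult0 pos_sign_mem)

lemma cycles_deg_contract: "f \<in> cycles_deg n u (Suc t) e \<Longrightarrow> contract j f \<in> cycles_deg n u t e"
  by (auto simp: cycles_deg_def cycles_contract contract_mem)

lemma cycles_deg_prepend:
  assumes "\<And>j. j < n \<Longrightarrow> y j \<in> cycles_deg n u t e" "\<And>T. (\<Sum>j<n. u j * y j T) = 0"
  shows "(\<lambda>S. \<Sum>j<n. prepend j (y j) S) \<in> cycles_deg n u (Suc t) e"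
  using assms by (auto simp: cycles_deg_def intro!: cycles_prepend G_sum prepend_mem)

lemma app_contract: "app i (\<lambda>k. contract j (x k)) r T = contract j (app i x r) T"
  by (simp add: app_def contract_def sum_distrib_left mult.left_commute)

lemma app_sum_prepend:
  "app i (\<lambda>k S. \<Sum>j\<in>J. prepend j (y j k) S) r S = (\<Sum>j\<in>J. prepend j (app i (y j) r) S)"
  unfolding app_def prepend_def sum_distrib_left
  by (subst sum.swap, intro sum.cong refl) (simp add: sum_distrib_left mult.left_commute)

lemma app_mult: "app i (\<lambda>k S. q * y k S) r S = q * app i y r S"
  by (simp add: app_def sum_distrib_left mult.left_commute)

lemma cycles_0_supp: "f \<in> cycles n u 0 \<Longrightarrow> S \<noteq> {} \<Longrightarrow> f S = 0"
  using finite_subset[of S "{..<n}"] by (auto simp: cycles_def wedge_pow_def)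

lemma cycles_0I:
  assumes "\<And>S. S \<noteq> {} \<Longrightarrow> f S = 0"
  shows "f \<in> cycles n u 0"
proof -
  have "S = {}" if "f S \<noteq> 0" for S using assms that by blast
  then have "f \<in> wedge_pow n 0" by (fastforce simp: wedge_pow_def)
  moreover have "contract j f T = 0" for j T using assms[of "insert j T"] by (simp add: contract_def)
  ultimately show ?thesis by (simp add: cycles_iff koszul_diff_def)
qed

text \<open>\<open>Z\<^sub>0\<close> is \<open>R\<close>, placed at the empty set, so this is the
  exactness of \<open>P\<close> itself; preimages chosen with small support stay in
  \<open>Z\<^sub>0\<close>.\<close>

lemma linear_cycles_0: "linear (cycles_deg n u 0) 0"
  unfolding linear_def
proof (intro allI impI)
  fix i d x
  assume x: "\<forall>j<B (Suc i). x j \<in> cycles_deg n u 0 (Suc d)" and x0: "\<forall>r<B i. \<forall>s. app i x r s = 0"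
  obtain y where y: "\<And>l k. y l k \<in> G d" "\<And>j. j < B (Suc i) \<Longrightarrow> x j = app (Suc i) y j"
    "\<And>l k. (\<And>j. j < B (Suc i) \<Longrightarrow> x j k = 0) \<Longrightarrow> y l k = 0"
    by (rule exact_pointwise[of i x d]) (use x x0 in \<open>auto simp: cycles_deg_def\<close>)
  have "y l \<in> cycles n u 0" for l
  proof (intro cycles_0I y(3))
    show "x j S = 0" if "S \<noteq> {}" "j < B (Suc i)" for S j
      using x that cycles_0_supp[of "x j" n u S] by (simp add: cycles_deg_def)
  qed
  then show "\<exists>y. (\<forall>k<B (Suc (Suc i)). y k \<in> cycles_deg n u 0 d) \<and> (\<forall>j<B (Suc i). x j = app (Suc i) y j)"
    using y(1,2) by (intro exI[of _ y]) (auto simp: cycles_deg_def)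
qed

lemma inverse_of_nat:
  assumes "(of_nat k :: 'a) \<noteq> 0"
  obtains q where "q \<in> G 0" "q * of_nat k = 1"
  using G_inv[OF G_of_nat assms] by (auto simp: mult.commute)

end

locale koszul_cycles = koszul_ring G B \<psi>
  for G :: "nat \<Rightarrow> 'a::comm_ring_1 set" and B \<psi> +
  fixes c n :: nat and u :: "nat \<Rightarrow> 'a"
  assumes gens: "min_hom_gens G c n u"
begin

abbreviation Z :: "nat \<Rightarrow> nat \<Rightarrow> (nat set \<Rightarrow> 'a) set" where
  "Z \<equiv> cycles_deg n u"

lemma u_deg: "j < n \<Longrightarrow> u j \<in> G c"
  using gens by (simp add: min_hom_gens_def)

text \<open>\<open>Z\<^sub>t\<^sub>+\<^sub>1\<close> is a direct summand of the kernel of \<open>F \<otimes> Z\<^sub>t \<rightarrow> \<mm>\<^sup>c Z\<^sub>t\<close>: contraction maps into this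
  kernel, the wedge product maps back, and the composite is multiplication by \<open>t + 1\<close>. The
  preimages \<open>y j\<close> of the contractions are therefore corrected to lie in the kernel.\<close>

lemma linear_cycles:
  assumes "\<forall>k\<in>{1..t}. (of_nat k :: 'a) \<noteq> 0"
  shows "linear (Z t) t"
  using assms
proof (induction t)
  case 0
  show ?case by (rule linear_cycles_0)
next
  case (Suc t)
  then have lin: "linear (Z t) t" by auto
  obtain q where q: "q \<in> G 0" "q * of_nat (Suc t) = 1"
    using inverse_of_nat Suc.prems by (metis atLeastAtMost_iff le_add1 order_refl plus_1_eq_Suc)
  show ?case
    unfolding linear_def
  proof (intro allI impI)
    fix i d x
    assume "Suc t \<le> d" and x: "\<forall>k<B (Suc i). x k \<in> Z (Suc t) (Suc d)"
      and x0: "\<forall>r<B i. \<forall>S. app i x r S = 0"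
    then obtain e where d: "d = Suc e" and e: "t \<le> e" by (cases d) auto
    \<comment> \<open>Contractions commute with \<open>app\<close>, so each of them turns
      \<open>x\<close> into a cycle over \<open>Z t\<close>, which lifts by the induction
      hypothesis.\<close>
    have "\<exists>y. (\<forall>k. y k \<in> Z t d) \<and> (\<forall>k<B (Suc i). contract j (x k) = app (Suc i) y k)" for j
    proof -
      have "app i (\<lambda>k. contract j (x k)) r S = 0" if "r < B i" for r S
      proof -
        have "app i x r = (\<lambda>S. 0)" using x0 that by auto
        then show ?thesis by (simp add: app_contract)
      qed
      then obtain y where "\<And>k. y k \<in> Z t d"
        "\<And>k. k < B (Suc i) \<Longrightarrow> contract j (x k) = app (Suc i) y k"
        using linearE[OF lin graded_module_cycles_deg, of d i "\<lambda>k. contract j (x k)"] x d e cycles_deg_contract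
        by (metis le_Suc_eq)
      then show ?thesis by blast
    qed
    then obtain y where y: "\<And>j k. y j k \<in> Z t d"
      "\<And>j k. k < B (Suc i) \<Longrightarrow> contract j (x k) = app (Suc i) (y j) k"
      by metis
    have app_u: "app i' (\<lambda>k S. \<Sum>j<n. u j * z j k S) r S = (\<Sum>j<n. u j * app i' (z j) r S)" for i' z r S
      using app_lincomb[of i' "\<lambda>j _. u j" z "\<lambda>_ S. S" "{..<n}" r S] by simp
    \<comment> \<open>The obstruction to \<open>y\<close> lying in the kernel of the map from
      \<open>F \<otimes> Z t\<close>. Its boundary is the tuple of Koszul differentials of
      \<open>x\<close>, hence zero.\<close>
    let ?\<eta> = "\<lambda>k S. \<Sum>j<n. u j * y j k S"
    have \<eta>: "?\<eta> k \<in> Z t (Suc (e + c))" for k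
      using graded_module_lincomb[OF graded_module_cycles_deg, of "{..<n}" u c "\<lambda>j. y j k" n u t d] u_deg y(1)
      by (simp add: d add.commute)
    obtain w where w: "\<And>l. w l \<in> Z t (e + c)" "\<And>l. l < B (Suc (Suc i)) \<Longrightarrow> ?\<eta> l = app (Suc (Suc i)) w l"
    proof (rule linearE[OF lin graded_module_cycles_deg, of "e + c" "Suc i" ?\<eta>])
      show "app (Suc i) ?\<eta> r S = 0" if "r < B (Suc i)" for r S
        using x that unfolding app_u y(2)[OF that, symmetric]
        by (simp add: cycles_deg_def cycles_iff koszul_diff_def)
    qed (use \<eta> e in auto)
    \<comment> \<open>Here \<open>e = d - 1\<close> has to be at least \<open>t\<close>, which is
      why the bound on \<open>d\<close> grows by one with each step of the induction.\<close>
    have "\<exists>v. (\<forall>j. v j \<in> Z t e) \<and> w l = (\<lambda>S. \<Sum>j<n. u j * v j S)" for l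
      by (rule linear_span_power[OF lin graded_module_cycles_deg e w(1)]) (rule min_hom_gens_span[OF gens])
    then have "\<forall>l. \<exists>v. (\<forall>j. v j \<in> Z t e) \<and> w l = (\<lambda>S. \<Sum>j<n. u j * v j S)" by blast
    from choice[OF this] obtain V
      where V: "\<And>l j. V l j \<in> Z t e" "\<And>l. w l = (\<lambda>S. \<Sum>j<n. u j * V l j S)" by blast
    define v where "v = (\<lambda>j l. V l j)"
    have v: "\<And>l j. v j l \<in> Z t e" "\<And>l. w l = (\<lambda>S. \<Sum>j<n. u j * v j l S)"
      unfolding v_def by (rule V)+
    let ?y = "\<lambda>j l S. y j l S - app (Suc (Suc i)) (v j) l S"
    have y': "?y j l \<in> Z t d" if "l < B (Suc (Suc i))" for j l
      using app_mem[OF graded_module_cycles_deg v(1) that] y(1) graded_module_diff[OF graded_module_cycles_deg] by (simp add: d)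
    have uy': "(\<Sum>j<n. u j * ?y j l S) = 0" if "l < B (Suc (Suc i))" for l S
    proof -
      have "w = (\<lambda>l S. \<Sum>j<n. u j * v j l S)" using v(2) by blast
      then have "(\<Sum>j<n. u j * app (Suc (Suc i)) (v j) l S) = app (Suc (Suc i)) w l S"
        by (simp add: app_u)
      also have "\<dots> = ?\<eta> l S" using fun_cong[OF w(2)[OF that], of S] by simp
      finally show ?thesis by (simp add: right_diff_distrib sum_subtractf)
    qed
    let ?z = "\<lambda>l S. q * (\<Sum>j<n. prepend j (?y j l) S)"
    have "?z l \<in> Z (Suc t) d" if "l < B (Suc (Suc i))" for l
      by (intro graded_module_mult0[OF graded_module_cycles_deg q(1)] cycles_deg_prepend) (use y' uy' that in auto)
    moreover have "x k = app (Suc i) ?z k" if k: "k < B (Suc i)" for k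
    proof
      fix S
      \<comment> \<open>The correction is a boundary and does not change the image.\<close>
      have "app (Suc i) (?y j) k = contract j (x k)" for j
        using y(2)[OF k] by (intro ext) (simp add: app_diff app_app[OF k])
      then have "app (Suc i) ?z k S = q * (\<Sum>j<n. prepend j (contract j (x k)) S)"
        by (simp add: app_mult app_sum_prepend)
      also have "\<dots> = q * of_nat (Suc t) * x k S"
        using x k prepend_contract_sum[of "x k" n "Suc t" S]
        by (simp only: cycles_deg_def cycles_iff mult.assoc) auto
      finally show "x k S = app (Suc i) ?z k S" by (simp only: q(2) mult_1)
    qed
    ultimately show "\<exists>y. (\<forall>l<B (Suc (Suc i)). y l \<in> Z (Suc t) d) \<and> (\<forall>k<B (Suc i). x k = app (Suc i) y k)"
      by (intro exI[of _ ?z]) auto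
  qed
qed

section \<open>Cycles of high degree as sums of products of 1-cycles\<close>

lemma cycles_deg_supp: "f \<in> Z t e \<Longrightarrow> S \<notin> Pow {..<n} \<Longrightarrow> f S = 0"
  by (auto simp: cycles_deg_def cycles_def wedge_pow_def)

lemma cycles_basis: "\<exists>m g. is_basis (Z t t) m g"
proof (rule homogeneous_basis[OF graded_module_cycles_deg])
  show "finite (Pow {..<n})" by simp
  show "f S \<in> G t" if "f \<in> Z t t" for f S using that by (simp add: cycles_deg_def)
qed (rule cycles_deg_supp)

text \<open>The lifts \<open>p j k\<close> of the contractions of \<open>f\<close> to the free module on the basis \<open>g\<close> of
  \<open>Z t t\<close> are corrected by syzygies, after which their columns are 1-cycles.\<close>

lemma cycles_deg_subset_cycles1_pow:
  assumes "\<forall>k\<in>{1..t}. (of_nat k :: 'a) \<noteq> 0" "f \<in> Z t e" "e \<ge> t"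
  shows "f \<in> cycles1_pow n u t"
  using assms
proof (induction t arbitrary: f e)
  case 0
  have "ext_one \<in> {foldr wedge zs ext_one |zs. length zs = 0 \<and> set zs \<subseteq> cycles n u 1}" by simp
  then have "(\<lambda>S. f {} * ext_one S) \<in> cycles1_pow n u 0"
    unfolding cycles1_pow_def by (intro rspan_mult rspan_base)
  moreover have "(\<lambda>S. f {} * ext_one S) = f"
    using 0 by (auto simp: ext_one_def cycles_deg_def cycles_0_supp)
  ultimately show ?case by simp
next
  case (Suc t)
  then have char: "\<forall>k\<in>{1..t}. (of_nat k :: 'a) \<noteq> 0" by auto
  have lin: "linear (Z t) t" by (rule linear_cycles[OF char])
  obtain q where q: "q \<in> G 0" "q * of_nat (Suc t) = 1"
    using inverse_of_nat Suc.prems(1) by (metis atLeastAtMost_iff le_add1 order_refl plus_1_eq_Suc)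
  \<comment> \<open>Degrees from \<open>t + 1\<close> on make \<open>e'\<close> positive, which puts
    it into the range where the syzygies of \<open>g\<close> are linear.\<close>
  obtain e' where e: "e = t + e'" "1 \<le> e'"
    using Suc.prems(3) by (metis add_Suc_right le_Suc_ex plus_1_eq_Suc le_add1 add_Suc)
  obtain m g where g: "is_basis (Z t t) m g" using cycles_basis by blast
  then have gZ: "g k \<in> Z t t" for k by (simp add: is_basis_def)
  have "\<exists>p. (\<forall>k. p k \<in> G e') \<and> (\<forall>k\<ge>m. p k = 0) \<and> contract j f = (\<lambda>S. \<Sum>k<m. p k * g k S)" for j
    by (rule linear_span_basis[OF lin graded_module_cycles_deg _ g]) (use cycles_deg_contract Suc.prems(2) e in auto)
  then obtain p where p: "\<And>j k. p j k \<in> G e'" "\<And>j k. k \<ge> m \<Longrightarrow> p j k = 0"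
    "\<And>j. contract j f = (\<lambda>S. \<Sum>k<m. p j k * g k S)"
    by metis
  \<comment> \<open>Combined with \<open>g\<close>, these coefficients give the Koszul differential
    of \<open>f\<close>, so they form a relation.\<close>
  let ?\<sigma> = "\<lambda>k. \<Sum>j<n. u j * p j k"
  have "(\<Sum>k<m. ?\<sigma> k * g k S) = 0" for S
  proof -
    have "(\<Sum>k<m. ?\<sigma> k * g k S) = (\<Sum>j<n. u j * (\<Sum>k<m. p j k * g k S))"
      unfolding sum_distrib_right sum_distrib_left by (subst sum.swap) (simp add: mult.assoc)
    also have "\<dots> = koszul_diff n u f S" by (simp add: koszul_diff_def p(3))
    also have "\<dots> = 0" using Suc.prems(2) by (simp add: cycles_deg_def cycles_iff)
    finally show ?thesis .
  qed
  moreover have "?\<sigma> k \<in> G (e' + c)" for k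
    by (intro G_sum, subst add.commute) (use u_deg p(1) in auto)
  ultimately have "?\<sigma> \<in> syz m g (e' + c)" using p(2) by (simp add: syz_def)
  \<comment> \<open>As the syzygies are linear from degree 1 on, a relation of degree
    \<open>e' + c\<close> is a combination of the \<open>u j\<close> with relations of degree
    \<open>e'\<close>.\<close>
  then have "\<exists>s. (\<forall>j. s j \<in> syz m g e') \<and> ?\<sigma> = (\<lambda>k. \<Sum>j<n. u j * s j k)"
    by (rule linear_span_power[OF linear_syz[OF lin graded_module_cycles_deg g] graded_module_syz e(2)])
      (rule min_hom_gens_span[OF gens])
  then obtain s where s: "\<And>j. s j \<in> syz m g e'" "?\<sigma> = (\<lambda>k. \<Sum>j<n. u j * s j k)" by blast
  let ?z = "\<lambda>k S. \<Sum>j<n. if S = {j} then p j k - s j k else 0"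
  have z: "?z k \<in> cycles n u 1" for k
    by (rule cycles_1I) (use fun_cong[OF s(2), of k] in \<open>simp add: right_diff_distrib sum_subtractf\<close>)
  have z_val: "?z k {j} = p j k - s j k" if "j < n" for j k
    using that by (simp add: eq_commute[of "{j}"])
  have "(\<lambda>S. \<Sum>k<m. q * wedge (?z k) (g k) S) \<in> cycles1_pow n u (Suc t)"
  proof -
    have "wedge (?z k) (g k) \<in> cycles1_pow n u (Suc t)" for k
      by (intro cycles1_pow_wedge z Suc.IH[OF char gZ]) simp
    then show ?thesis unfolding cycles1_pow_def by (intro rspan_sum rspan_mult)
  qed
  moreover have "(\<Sum>k<m. q * wedge (?z k) (g k) S) = f S" for S
  proof -
    \<comment> \<open>The relations \<open>s j\<close> vanish on \<open>g\<close>, so the corrected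
      coefficients still represent the contractions of \<open>f\<close>.\<close>
    have lift: "(\<lambda>S. \<Sum>k<m. (p j k - s j k) * g k S) = contract j f" for j
      using s(1)[of j] by (auto simp: p(3) syz_def left_diff_distrib sum_subtractf)
    have "wedge (?z k) (g k) S = (\<Sum>j<n. (p j k - s j k) * prepend j (g k) S)" for k
      using wedge_one_left[of "?z k" n "g k" t S] z[of k] gZ[of k] z_val
      by (simp add: cycles_iff cycles_deg_def)
    then have "(\<Sum>k<m. wedge (?z k) (g k) S) = (\<Sum>j<n. \<Sum>k<m. (p j k - s j k) * prepend j (g k) S)"
      by (simp only:) (rule sum.swap)
    also have "\<dots> = (\<Sum>j<n. prepend j (contract j f) S)"
      by (simp add: lift[symmetric] prepend_sum prepend_mult)
    also have "\<dots> = of_nat (Suc t) * f S"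
      using Suc.prems(2) by (intro prepend_contract_sum) (simp add: cycles_deg_def cycles_iff)
    finally have "q * (\<Sum>k<m. wedge (?z k) (g k) S) = q * of_nat (Suc t) * f S"
      by (simp only: mult.assoc)
    then show ?thesis by (simp only: q(2) mult_1 sum_distrib_left)
  qed
  ultimately show ?case by simp
qed

text \<open>This is where minimality of the generators enters.\<close>

lemma cycles_1_low:
  assumes "z \<in> cycles n u 1" "j < n"
  shows "z {j} \<in> low 1"
proof -
  have "(\<Sum>j<n. hcomp 0 (z {j}) * u j) = hcomp (c + 0) (\<Sum>j<n. u j * z {j})"
    unfolding hcomp_sum
    by (rule sum.cong) (simp_all add: hcomp_mult_homog_shift[OF u_deg, of _ 0, simplified] mult.commute)
  then have "(\<Sum>j<n. hcomp 0 (z {j}) * u j) = 0" using cycles_1D[OF assms(1)] by simp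
  from min_hom_gens_indep[OF gens _ this assms(2)] show ?thesis by (simp add: low_def)
qed

text \<open>Coefficients of 1-cycles have positive order, so those of a product of \<open>t\<close>
  of them have order at least \<open>t\<close>. This is the half of the comparison with the
  truncated cycles that excludes degrees below \<open>t\<close>.\<close>

lemma cycles1_pow_low:
  assumes "f \<in> cycles1_pow n u t"
  shows "f \<in> cycles n u t \<and> (\<forall>S. f S \<in> low t)"
proof -
  have prods: "foldr wedge zs ext_one \<in> cycles n u (length zs) \<and> (\<forall>S. foldr wedge zs ext_one S \<in> low (length zs))"
    if "set zs \<subseteq> cycles n u 1" for zs
    using that
  proof (induction zs)
    case Nil
    have "ext_one \<in> cycles n u 0" by (rule cycles_0I) (simp add: ext_one_def)
    then show ?case by (simp add: low_def)
  next
    case (Cons z zs)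
    let ?y = "foldr wedge zs ext_one"
    have z: "z \<in> cycles n u 1" and y: "?y \<in> cycles n u (length zs)" "\<And>S. ?y S \<in> low (length zs)"
      using Cons by auto
    have wedge: "wedge z ?y = (\<lambda>S. \<Sum>j<n. prepend j (\<lambda>S. z {j} * ?y S) S)"
      using wedge_one_left[of z n ?y "length zs"] z y(1) by (auto simp: cycles_iff prepend_mult)
    have "wedge z ?y \<in> cycles n u (Suc (length zs))"
      unfolding wedge
    proof (rule cycles_prepend)
      show "(\<Sum>j<n. u j * (z {j} * ?y T)) = 0" for T
        using cycles_1D[OF z] by (simp add: mult.assoc[symmetric] sum_distrib_right[symmetric])
    qed (intro cycles_mult y)
    moreover have "wedge z ?y S \<in> low (Suc (length zs))" for S
      unfolding wedge
    proof (rule low_sum)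
      fix j assume "j \<in> {..<n}"
      then have "z {j} * ?y (S - {j}) \<in> low (1 + length zs)"
        by (intro low_mult cycles_1_low z y) simp
      moreover have "pos_sign j S \<in> low 0" by (simp add: low_def)
      ultimately have "pos_sign j S * (z {j} * ?y (S - {j})) \<in> low (0 + (1 + length zs))"
        by (rule low_mult[rotated])
      then show "prepend j (\<lambda>S. z {j} * ?y S) S \<in> low (Suc (length zs))"
        by (simp add: prepend_def low_def)
    qed
    ultimately show ?case by simp
  qed
  show ?thesis
    using assms unfolding cycles1_pow_def
  proof (induction f rule: rspan_induct)
    case zero
    show ?case by (simp add: cycles_zero low_def)
  next
    case (add r v f)
    then have v: "v \<in> cycles n u t" "\<And>S. v S \<in> low t" using prods by auto
    have "r * v S \<in> low t" for S using low_mult[of r 0 "v S" t] v(2) by (simp add: low_def)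
    then show ?case using add.IH v(1) by (auto intro: cycles_add cycles_mult simp: low_def hcomp_add)
  qed
qed

section \<open>Powers of the 1-cycles as truncations, and their resolution\<close>

lemma hcomp_cycles:
  assumes "f \<in> cycles n u t"
  shows "(\<lambda>S. hcomp e (f S)) \<in> Z t e"
proof -
  have contract: "contract j (\<lambda>S. hcomp e (f S)) T = hcomp e (contract j f T)" for j T
    using hcomp_mult_homog_shift[OF pos_sign_mem, of e j] by (auto simp: contract_def)
  have "koszul_diff n u (\<lambda>S. hcomp e (f S)) T = hcomp (c + e) (koszul_diff n u f T)" for T
    unfolding koszul_diff_def hcomp_sum contract
    by (rule sum.cong) (auto simp: hcomp_mult_homog_shift[OF u_deg])
  moreover have "(\<lambda>S. hcomp e (f S)) \<in> wedge_pow n t"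
    using assms unfolding cycles_iff wedge_pow_def mem_Collect_eq by (metis hcomp_zero)
  ultimately show ?thesis using assms by (simp add: cycles_deg_def cycles_iff)
qed

text \<open>The module is the truncation of the cycles in degrees at least \<open>t\<close>: lower
  components vanish, and higher ones are products of 1-cycles. So a basis of \<open>Z t t\<close>
  generates it, and the relations of this basis have a linear resolution.\<close>

lemma cycles1_pow_resolution:
  assumes "\<forall>k\<in>{1..t}. (of_nat k :: 'a) \<noteq> 0"
  shows "ext_linear_resolution G c t (cycles1_pow n u t)"
proof -
  have lin: "linear (Z t) t" by (rule linear_cycles[OF assms])
  obtain m g where g: "is_basis (Z t t) m g" using cycles_basis by blast
  then have gZ: "g k \<in> Z t t" for k by (simp add: is_basis_def)
  have gG: "g k S \<in> G t" for k S using gZ[of k] by (simp add: cycles_deg_def)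
  obtain b \<phi> where b: "b 0 = m" "rel m g = mat_im (\<phi> 0) (b 0) (b 1)" "linear_tail G b \<phi>"
    using linear_resolution[OF linear_syz[OF lin graded_module_cycles_deg g] syz_basis_zero[OF g] gG] by blast
  have "(\<lambda>x S. \<Sum>j<m. x j * g j S) ` vecs m = cycles1_pow n u t"
  proof
    have "g k \<in> cycles1_pow n u t" for k
      by (rule cycles_deg_subset_cycles1_pow[OF assms gZ order_refl])
    then show "(\<lambda>x S. \<Sum>j<m. x j * g j S) ` vecs m \<subseteq> cycles1_pow n u t"
      unfolding cycles1_pow_def by (intro image_subsetI rspan_sum rspan_mult)
    show "cycles1_pow n u t \<subseteq> (\<lambda>x S. \<Sum>j<m. x j * g j S) ` vecs m"
    proof
      fix f assume "f \<in> cycles1_pow n u t"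
      then have f: "f \<in> cycles n u t" "\<And>S. f S \<in> low t" using cycles1_pow_low by auto
      have "\<exists>p\<in>vecs m. f = (\<lambda>S. \<Sum>k<m. p k * g k S)"
      proof (rule span_of_hcomp)
        show "finite (Pow {..<n})" by simp
        show "f S = 0" if "S \<notin> Pow {..<n}" for S
          using f(1) that by (auto simp: cycles_iff wedge_pow_def)
        show "\<forall>k<m. g k S = 0" if "S \<notin> Pow {..<n}" for S
          using cycles_deg_supp[OF gZ that] by simp
        show "\<exists>p. (\<lambda>S. hcomp e (f S)) = (\<lambda>S. \<Sum>k<m. p k * g k S)" for e
        proof (cases "e < t")
          case True
          then show ?thesis using f(2) by (intro exI[of _ "\<lambda>_. 0"]) (auto simp: low_def)
        next
          case False
          then have "(\<lambda>S. hcomp e (f S)) \<in> Z t (t + (e - t))" using hcomp_cycles[OF f(1), of e] by simp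
          from linear_span_basis[OF lin graded_module_cycles_deg this g] show ?thesis by blast
        qed
      qed
      then show "f \<in> (\<lambda>x S. \<Sum>j<m. x j * g j S) ` vecs m" by blast
    qed
  qed
  moreover have "{x \<in> vecs m. (\<lambda>S. \<Sum>j<m. x j * g j S) = (\<lambda>S. 0)} = rel m g"
    by (simp add: rel_def fun_eq_iff)
  \<comment> \<open>The generators have coefficients of degree \<open>t\<close> at basis elements of
    degree \<open>t * c\<close>.\<close>
  moreover have "ext_homog G c t (t * (c + 1)) (g j)" for j
    using gG by (simp add: ext_homog_def)
  ultimately show ?thesis
    unfolding ext_linear_resolution_def
    by (intro exI[of _ "t * (c + 1)"] exI[of _ b] exI[of _ g] exI[of _ \<phi>]) (simp add: b)
qed

end

text \<open>That \<open>1, ..., t\<close> are nonzero in the ring expresses that the characteristic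
  is 0 or greater than \<open>t\<close>. Vanishing of the quotient in degree \<open>d\<close> means
  that homogeneous cycles of this degree lie in \<open>cycles1_pow n u t\<close>.\<close>

theorem theorem5p2:
  fixes G :: "nat \<Rightarrow> 'a::comm_ring_1 set"
    and c t n :: nat
    and u :: "nat \<Rightarrow> 'a"
  assumes "standard_graded G"
    and "koszul G"
    and "c \<ge> 1" and "t \<ge> 1"
    and "\<forall>k\<in>{1..t}. (of_nat k :: 'a) \<noteq> 0"
    and "min_hom_gens G c n u"
  shows "(\<forall>d\<ge>t * (c + 1). \<forall>x\<in>cycles n u t. ext_homog G c t d x \<longrightarrow> x \<in> cycles1_pow n u t)
         \<and> ext_linear_resolution G c t (cycles1_pow n u t)"
proof -
  interpret graded_ring G using assms(1) by unfold_locales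
  obtain B \<psi> where "koszul_ring G B \<psi>" using koszul_ringI[OF assms(2)] by blast
  then interpret koszul_ring G B \<psi> .
  interpret koszul_cycles G B \<psi> c n u using assms(6) by unfold_locales
  have "x \<in> cycles1_pow n u t"
    if "d \<ge> t * (c + 1)" "x \<in> cycles n u t" "ext_homog G c t d x" for d x
  proof (rule cycles_deg_subset_cycles1_pow[OF assms(5)])
    \<comment> \<open>Subtracting \<open>t * c\<close> passes to the normalised degree, where the
      bound becomes \<open>t\<close>.\<close>
    show "x \<in> cycles_deg n u t (d - t * c)"
      using that by (simp add: ext_homog_def cycles_deg_def)
    show "d - t * c \<ge> t" using that(1) by simp
  qed
  then show ?thesis using cycles1_pow_resolution[OF assms(5)] by blast
qed

end
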